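(* Let $G=[6,3,m]$ with $m=6$ or $\infty$, and let $p\geq 3$ be a prime. If $m=6$, then $G^p$ is a (string) C-group for $p=3$ and for no other odd prime $p$. If $m=\infty$, then $G^p$ is a (string) C-group if and only if $p=3$ or $p\equiv\pm5\pmod{12}$.
   Context: Setting. $G=\langle r_0,\dots,r_{n-1}\rangle=[p_1,\dots,p_{n-1}]$ denotes a crystallographic Coxeter group with string Coxeter diagram (nodes $0,\dots,n-1$; the branch joining nodes $i-1$ and $i$ is marked $p_i$; $p_i=2$ means no branch), so each $p_i\in\{2,3,4,6,\infty\}$, in its standard representation as a reflection group on real $n$-space $V$. A basic system is a basis $b_0,\dots,b_{n-1}$ of $V$ of suitably rescaled simple roots: $b_i\cdot b_i>0$, $b_{i-1}\cdot b_i=-\cos(\pi/p_i)\sqrt{(b_{i-1}\cdot b_{i-1})(b_i\cdot b_i)}$ (with $\cos(\pi/\infty)=1$), $b_i\cdot b_j=0$ for $|i-j|\ge2$, $r_i(x)=x-2\frac{x\cdot b_i}{b_i\cdot b_i}b_i$, and all numbers $2\frac{b_i\cdot b_j}{b_i\cdot b_i}$ are integers. Reduction. For an odd prime $p$, the integer matrices of the $r_i$ in the basis $(b_i)$ are reduced modulo $p$; $G^p$ is the subgroup of $GL_n(\mathbb Z_p)$ (where $\mathbb Z_p=\mathbb Z/p\mathbb Z$) generated by these reductions, again denoted $r_0,\dots,r_{n-1}$. In some cases with $p=3$ and some $p_i=6$, $G^p$ may depend on the basic system; the statement refers to any choice of basic system. $G^p$ is a (string) C-group if $\langle r_i\mid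 i\in I\rangle\cap\langle r_i\mid i\in J\rangle=\langle r_i\mid i\in I\cap J\rangle$ in $G^p$ for all $I,J\subseteq\{0,\dots,n-1\}$. *)

theory Defs
  imports
    Complex_Main
    "HOL-Library.Extended_Nat"
    "HOL-Number_Theory.Cong"
    "HOL-Algebra.Generated_Groups"
    "Jordan_Normal_Form.Matrix"
    "Berlekamp_Zassenhaus.Finite_Field"
begin

text \<open>
  The string Coxeter group \<open>[p\<^sub>1, \<dots>, p\<^sub>n\<^sub>-\<^sub>1]\<close> is given by the list \<open>ps\<close> of its marks; it has
  \<open>length ps + 1\<close> nodes, and the entry \<open>ps ! i\<close> (counted from 0) marks the branch joining
  the nodes \<open>i\<close> and \<open>i + 1\<close>.
\<close>

definition rank :: "enat list \<Rightarrow> nat" where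
  "rank ps = length ps + 1"

definition crystallographic :: "enat list \<Rightarrow> bool" where
  "crystallographic ps \<longleftrightarrow> set ps \<subseteq> {2, 3, 4, 6, \<infinity>}"

definition cos_mark :: "enat \<Rightarrow> real" where
  "cos_mark q = (case q of enat k \<Rightarrow> cos (pi / real k) | \<infinity> \<Rightarrow> 1)"

text \<open>
  The form \<open>B\<close> need be neither positive definite nor nondegenerate, as is
  usual for the standard representation of an infinite Coxeter group.
\<close>

definition symmetric_bilinear_form :: "('v::real_vector \<Rightarrow> 'v \<Rightarrow> real) \<Rightarrow> bool" where
  "symmetric_bilinear_form B \<longleftrightarrow> (\<forall>x. linear (B x)) \<and> (\<forall>x y. B x y = B y x)"

definition indexed_basis :: "nat \<Rightarrow> (nat \<Rightarrow> 'v::real_vector) \<Rightarrow> bool" where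
  "indexed_basis n b \<longleftrightarrow>
     inj_on b {..<n} \<and> independent (b ` {..<n}) \<and> span (b ` {..<n}) = UNIV"

text \<open>
  \<open>r 0, \<dots>, r (rank ps - 1)\<close> are the generating reflections of the group with marks \<open>ps\<close> in its
  standard representation on the space \<open>'v\<close> with form \<open>B\<close>, and \<open>b\<close> is a basic system for it.
\<close>

definition basic_system ::
  "('v::real_vector \<Rightarrow> 'v \<Rightarrow> real) \<Rightarrow> enat list \<Rightarrow> (nat \<Rightarrow> 'v \<Rightarrow> 'v) \<Rightarrow> (nat \<Rightarrow> 'v) \<Rightarrow> bool" where
  "basic_system B ps r b \<longleftrightarrow>
     crystallographic ps \<and>
     symmetric_bilinear_form B \<and>
     indexed_basis (rank ps) b \<and>
     (\<forall>i<rank ps. B (b i) (b i) > 0) \<and>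
     (\<forall>i. Suc i < rank ps \<longrightarrow>
        B (b i) (b (Suc i)) =
          - cos_mark (ps ! i) * sqrt (B (b i) (b i) * B (b (Suc i)) (b (Suc i)))) \<and>
     (\<forall>i<rank ps. \<forall>j<rank ps. i + 2 \<le> j \<longrightarrow> B (b i) (b j) = 0) \<and>
     (\<forall>i<rank ps. \<forall>x. r i x = x - (2 * B x (b i) / B (b i) (b i)) *\<^sub>R b i) \<and>
     (\<forall>i<rank ps. \<forall>j<rank ps. 2 * B (b i) (b j) / B (b i) (b i) \<in> \<int>)"

definition matrix_wrt :: "nat \<Rightarrow> (nat \<Rightarrow> 'v::real_vector) \<Rightarrow> ('v \<Rightarrow> 'v) \<Rightarrow> real mat" where
  "matrix_wrt n b f = mat n n (\<lambda>(i, j). representation (b ` {..<n}) (f (b j)) (b i))"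

text \<open>
  Entrywise reduction modulo \<open>p = CARD('p)\<close>; it is only meant for matrices with integer
  entries (such as those of the \<open>r i\<close> in a basic system), on which the floor is exact.
\<close>

definition reduce_mat :: "real mat \<Rightarrow> 'p::prime_card mod_ring mat" where
  "reduce_mat A = map_mat (\<lambda>x. of_int \<lfloor>x\<rfloor>) A"

definition reduced_gen ::
  "enat list \<Rightarrow> (nat \<Rightarrow> 'v::real_vector \<Rightarrow> 'v) \<Rightarrow> (nat \<Rightarrow> 'v) \<Rightarrow> nat \<Rightarrow> 'p::prime_card mod_ring mat" where
  "reduced_gen ps r b i = reduce_mat (matrix_wrt (rank ps) b (r i))"

definition GL :: "'p::prime_card itself \<Rightarrow> nat \<Rightarrow> 'p mod_ring mat monoid" where
  "GL ty n = units_of (ring_mat TYPE('p mod_ring) n ())"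

definition reduced_group ::
  "'p::prime_card itself \<Rightarrow> enat list \<Rightarrow> (nat \<Rightarrow> 'v::real_vector \<Rightarrow> 'v) \<Rightarrow> (nat \<Rightarrow> 'v) \<Rightarrow>
   'p mod_ring mat monoid" where
  "reduced_group ty ps r b =
     (GL ty (rank ps))\<lparr>carrier := generate (GL ty (rank ps)) (reduced_gen ps r b ` {..<rank ps})\<rparr>"

definition is_C_group :: "('g, 'c) monoid_scheme \<Rightarrow> nat \<Rightarrow> (nat \<Rightarrow> 'g) \<Rightarrow> bool" where
  "is_C_group H n s \<longleftrightarrow>
     (\<forall>I J. I \<subseteq> {..<n} \<longrightarrow> J \<subseteq> {..<n} \<longrightarrow>
        generate H (s ` I) \<inter> generate H (s ` J) = generate H (s ` (I \<inter> J)))"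

definition reduction_is_C_group ::
  "'p::prime_card itself \<Rightarrow> enat list \<Rightarrow> (nat \<Rightarrow> 'v::real_vector \<Rightarrow> 'v) \<Rightarrow> (nat \<Rightarrow> 'v) \<Rightarrow> bool" where
  "reduction_is_C_group ty ps r b \<longleftrightarrow>
     is_C_group (reduced_group ty ps r b) (rank ps) (reduced_gen ps r b)"

end

theory Submission
  imports Defs "HOL-Library.Product_Plus" "HOL-Number_Theory.Quadratic_Reciprocity"
begin

text \<open>
  Only the Cartan integers of the basic system enter the reduced matrices.  For opposite
  entries their products are \<open>4 cos\<^sup>2 (\<pi>/p\<^sub>i)\<close>, that is \<open>3\<close>, \<open>1\<close>, and \<open>3\<close> or \<open>4\<close>.  So the reduced
  group is generated by four explicit reflections of \<open>F\<^sup>4\<close>, where \<open>F\<close> is the field of \<open>p\<close>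
  elements, with parameters satisfying \<open>a a' = 3\<close>, and \<open>d d' = 3\<close> (when \<open>m = 6\<close>) or \<open>d d' = 4\<close>
  (when \<open>m = \<infinity>\<close>).  These equations are all that the argument uses about the basic system.

  By the usual criterion for string groups (\<open>string_criterion\<close>), the only thing to decide is
  whether the end subgroups \<open>\<langle>r\<^sub>0, r\<^sub>1, r\<^sub>2\<rangle>\<close> and \<open>\<langle>r\<^sub>1, r\<^sub>2, r\<^sub>3\<rangle>\<close> meet in \<open>\<langle>r\<^sub>1, r\<^sub>2\<rangle>\<close>, which is a
  symmetric group \<open>S\<^sub>3\<close>.

  Let \<open>p > 3\<close>.  The first end subgroup is the reduction of the plane crystallographic group
  \<open>[6,3]\<close>; it fixes a vector \<open>c\<close>, and modulo \<open>c\<close> the reflection \<open>r\<^sub>0\<close> acts as \<open>- r\<^sub>2\<close>, so that the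
  group acts on the plane of \<open>b\<^sub>1, b\<^sub>2\<close> as \<open>{1, -1} \<times> S\<^sub>3\<close> (\<open>point_group\<close>).  A common element outside
  \<open>S\<^sub>3\<close> can therefore be taken to be a half-turn, equal to \<open>-1\<close> on that plane.  Conversely, the
  translations of \<open>[6,3]\<close> reduce to a full vector space over \<open>F\<close>, in which division by \<open>3\<close> is
  possible; hence the half-turn \<open>(r\<^sub>0 r\<^sub>1)\<^sup>3\<close> can be moved to the centre of \<open>S\<^sub>3\<close>, although the
  crystallographic group has only a threefold rotation there (\<open>half_turn_012\<close>).

  For \<open>m = 6\<close> the diagram is symmetric, so the second end subgroup contains the same half-turn and
  the intersection property fails.  For \<open>m = \<infinity>\<close> the second end subgroup is the reduction of
  \<open>[3,\<infinity>]\<close>, which is \<open>PGL\<^sub>2(\<int>)\<close> acting on binary quadratic forms by substitution (\<open>substitution\<close>).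
  The half-turn corresponds to a substitution with entries \<open>\<plusminus>u, \<plusminus>2u\<close> where \<open>3 u\<^sup>2 = 1\<close>.  Such an \<open>u\<close>
  exists exactly when \<open>3\<close> is a square in \<open>F\<close>, and then the substitution is a product of
  transvections in the group (\<open>half_turn_square\<close>, \<open>half_turn_123_hyperbolic\<close>).  Quadratic
  reciprocity turns this into \<open>p \<equiv> \<plusminus>1 (mod 12)\<close>.

  For \<open>p = 3\<close> one of \<open>a\<close>, \<open>a'\<close> vanishes, so \<open>r\<^sub>0\<close> acts trivially on the quotient by \<open>b\<^sub>0\<close> (if \<open>a' = 0\<close>)
  or on the span of \<open>b\<^sub>1, b\<^sub>2, b\<^sub>3\<close> (if \<open>a = 0\<close>), and there the first end subgroup acts as \<open>S\<^sub>3\<close>.  In the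
  first case this already confines the intersection to \<open>S\<^sub>3\<close>.  In the second case the other end
  subgroup either degenerates in one of these two ways or fixes a vector outside that span, which
  again suffices.
\<close>

section \<open>Groups generated by involutions\<close>

text \<open>
  For involutions, products of generators already form a group, so inverses need no
  separate clause.
\<close>

inductive_set word_maps :: "(nat \<Rightarrow> 'v \<Rightarrow> 'v) \<Rightarrow> nat set \<Rightarrow> ('v \<Rightarrow> 'v) set"
  for s :: "nat \<Rightarrow> 'v \<Rightarrow> 'v" and I :: "nat set" where
  word_id: "id \<in> word_maps s I"
| word_step: "i \<in> I \<Longrightarrow> g \<in> word_maps s I \<Longrightarrow> s i \<circ> g \<in> word_maps s I"

lemma word_gen: "i \<in> I \<Longrightarrow> s i \<in> word_maps s I"
  using word_step[OF _ word_id] by fastforce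

lemma word_comp:
  assumes "g \<in> word_maps s I" "h \<in> word_maps s I"
  shows "g \<circ> h \<in> word_maps s I"
  using assms by (induction rule: word_maps.induct) (auto simp: comp_assoc intro: word_step)

lemma word_mono:
  assumes "I \<subseteq> J"
  shows "word_maps s I \<subseteq> word_maps s J"
proof
  fix g assume "g \<in> word_maps s I"
  then show "g \<in> word_maps s J"
    using assms by (induction rule: word_maps.induct) (auto intro: word_id word_step)
qed

lemma word_weaken: "g \<in> word_maps s I \<Longrightarrow> I \<subseteq> J \<Longrightarrow> g \<in> word_maps s J"
  using word_mono by blast

lemma word_empty: "word_maps s {} = {id}"
proof
  show "word_maps s {} \<subseteq> {id}"
  proof
    fix g assume "g \<in> word_maps s {}"
    then show "g \<in> {id}" by (induction rule: word_maps.induct) auto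
  qed
qed (simp add: word_id)

lemma word_inverse:
  assumes "\<And>i. i \<in> I \<Longrightarrow> s i \<circ> s i = id" and "g \<in> word_maps s I"
  obtains h where "h \<in> word_maps s I" "h \<circ> g = id" "g \<circ> h = id"
proof -
  have "\<exists>h \<in> word_maps s I. h \<circ> g = id \<and> g \<circ> h = id"
    using assms(2)
  proof (induction rule: word_maps.induct)
    case word_id
    show ?case by (intro bexI[of _ id]) (auto intro: word_maps.word_id)
  next
    case (word_step i g)
    then obtain h where h: "h \<in> word_maps s I" "h \<circ> g = id" "g \<circ> h = id" by blast
    have ss: "s i \<circ> s i = id" using assms(1) word_step by blast
    have "h \<circ> s i \<circ> (s i \<circ> g) = h \<circ> (s i \<circ> s i) \<circ> g"
      and "s i \<circ> g \<circ> (h \<circ> s i) = s i \<circ> (g \<circ> h) \<circ> s i"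
      by (simp_all only: comp_assoc)
    then have "h \<circ> s i \<circ> (s i \<circ> g) = id" "s i \<circ> g \<circ> (h \<circ> s i) = id"
      using h ss by simp_all
    moreover have "h \<circ> s i \<in> word_maps s I"
      using h word_step by (intro word_comp word_gen)
    ultimately show ?case by blast
  qed
  then show thesis using that by blast
qed

lemma word_commute:
  assumes "\<And>i j. i \<in> I \<Longrightarrow> j \<in> J \<Longrightarrow> s i \<circ> s j = s j \<circ> s i"
    and "g \<in> word_maps s I" "h \<in> word_maps s J"
  shows "g \<circ> h = h \<circ> g"
proof -
  have 1: "s i \<circ> h = h \<circ> s i" if "i \<in> I" for i
    using assms(3)
  proof (induction rule: word_maps.induct)
    case (word_step j h)
    then show ?case using assms(1)[OF that] by (metis comp_assoc)
  qed simp
  show ?thesis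
    using assms(2)
  proof (induction rule: word_maps.induct)
    case (word_step i g)
    then show ?case using 1 by (metis comp_assoc)
  qed simp
qed

lemma word_split:
  assumes comm: "\<And>i j. i \<in> I \<Longrightarrow> j \<in> J \<Longrightarrow> s i \<circ> s j = s j \<circ> s i"
    and "g \<in> word_maps s (I \<union> J)"
  obtains a b where "a \<in> word_maps s I" "b \<in> word_maps s J" "g = a \<circ> b"
proof -
  have "\<exists>a \<in> word_maps s I. \<exists>b \<in> word_maps s J. g = a \<circ> b"
    using assms(2)
  proof (induction rule: word_maps.induct)
    case word_id
    show ?case by (intro bexI[of _ id]) (auto intro: word_maps.word_id)
  next
    case (word_step i g)
    then obtain a b where ab: "a \<in> word_maps s I" "b \<in> word_maps s J" "g = a \<circ> b" by blast
    from \<open>i \<in> I \<union> J\<close> show ?case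
    proof
      assume "i \<in> I"
      then have "s i \<circ> a \<in> word_maps s I" "s i \<circ> g = (s i \<circ> a) \<circ> b"
        using ab by (auto simp: comp_assoc intro: word_maps.word_step)
      then show ?thesis using ab by blast
    next
      assume j: "i \<in> J"
      then have "s i \<circ> b \<in> word_maps s J" using ab by (auto intro: word_maps.word_step)
      moreover have "a \<circ> s i = s i \<circ> a"
        using word_commute[OF comm ab(1) word_gen[OF j]] by simp
      then have "s i \<circ> g = a \<circ> (s i \<circ> b)"
        using ab by (metis comp_assoc)
      ultimately show ?thesis using ab by blast
    qed
  qed
  then show thesis using that by blast
qed

definition intersection_property :: "(nat \<Rightarrow> 'v \<Rightarrow> 'v) \<Rightarrow> nat set \<Rightarrow> bool" where
  "intersection_property s N \<longleftrightarrow>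
     (\<forall>I J. I \<subseteq> N \<longrightarrow> J \<subseteq> N \<longrightarrow> word_maps s I \<inter> word_maps s J = word_maps s (I \<inter> J))"

lemma intersection_property_single: "intersection_property s {i}"
proof -
  have "word_maps s I \<inter> word_maps s J = word_maps s (I \<inter> J)"
    if "I \<subseteq> {i}" "J \<subseteq> {i}" for I J
  proof -
    have "I = {} \<or> I = {i}" "J = {} \<or> J = {i}" using that by blast+
    then show ?thesis using word_id by (auto simp: word_empty)
  qed
  then show ?thesis by (simp add: intersection_property_def)
qed

text \<open>
  A pair \<open>I\<close>, \<open>J\<close> of proper subsets of an interval omits some \<open>j\<close> and \<open>k\<close>, and generators on
  different sides of an omitted one commute.  So a common element factors as \<open>a \<circ> b\<close> along the gap
  of \<open>I\<close> and as \<open>c \<circ> d\<close> along the gap of \<open>J\<close>; comparing the two factorisations reduces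
  everything to the two end subgroups.
\<close>

lemma string_criterion:
  fixes s :: "nat \<Rightarrow> 'v \<Rightarrow> 'v" and lo hi :: nat
  assumes invol: "\<And>i. i \<in> {lo..hi} \<Longrightarrow> s i \<circ> s i = id"
    and comm: "\<And>i j. i \<in> {lo..hi} \<Longrightarrow> j \<in> {lo..hi} \<Longrightarrow> i + 2 \<le> j \<Longrightarrow> s i \<circ> s j = s j \<circ> s i"
    and left: "intersection_property s {lo..<hi}"
    and right: "intersection_property s {lo<..hi}"
    and core: "word_maps s {lo..<hi} \<inter> word_maps s {lo<..hi} \<subseteq> word_maps s {lo<..<hi}"
  shows "intersection_property s {lo..hi}"
proof -
  let ?W = "word_maps s"
  have L: "?W I \<inter> ?W J = ?W (I \<inter> J)" if "I \<subseteq> {lo..<hi}" "J \<subseteq> {lo..<hi}" for I J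
    using left that unfolding intersection_property_def by blast
  have R: "?W I \<inter> ?W J = ?W (I \<inter> J)" if "I \<subseteq> {lo<..hi}" "J \<subseteq> {lo<..hi}" for I J
    using right that unfolding intersection_property_def by blast
  \<comment> \<open>Intersections of a subgroup of the left end with one of the right end pass through the middle.\<close>
  have LR: "?W I \<inter> ?W J \<subseteq> ?W (I \<inter> J)" if "I \<subseteq> {lo..<hi}" "J \<subseteq> {lo<..hi}" for I J
  proof
    fix g assume g: "g \<in> ?W I \<inter> ?W J"
    then have in_mid: "g \<in> ?W {lo<..<hi}"
      using core word_mono[OF that(1), of s] word_mono[OF that(2), of s] by blast
    have sub: "{lo<..<hi} \<subseteq> {lo..<hi}" "{lo<..<hi} \<subseteq> {lo<..hi}" by auto
    from in_mid have "g \<in> ?W (I \<inter> {lo<..<hi})" "g \<in> ?W (J \<inter> {lo<..<hi})"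
      using g L[of I "{lo<..<hi}"] R[of J "{lo<..<hi}"] that sub by blast+
    then have "g \<in> ?W ((I \<inter> {lo<..<hi}) \<inter> (J \<inter> {lo<..<hi}))"
      using L[of "I \<inter> {lo<..<hi}" "J \<inter> {lo<..<hi}"] sub by blast
    then show "g \<in> ?W (I \<inter> J)"
      using word_mono[of "(I \<inter> {lo<..<hi}) \<inter> (J \<inter> {lo<..<hi})" "I \<inter> J" s] by blast
  qed
  have main: "?W I \<inter> ?W J \<subseteq> ?W (I \<inter> J)"
    if IJ: "I \<subseteq> {lo..hi}" "J \<subseteq> {lo..hi}"
      and j: "j \<in> {lo..hi}" "j \<notin> I" and k: "k \<in> {lo..hi}" "k \<notin> J" and "j \<le> k" for I J j k
  proof
    fix g assume g: "g \<in> ?W I \<inter> ?W J"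
    define I1 I2 J1 J2 where defs: "I1 = I \<inter> {..<j}" "I2 = I \<inter> {j<..}"
      "J1 = J \<inter> {..<k}" "J2 = J \<inter> {k<..}"
    have Ieq: "I = I1 \<union> I2" and Jeq: "J = J1 \<union> J2"
      using j k by (auto simp: defs not_less le_less)
    have "s x \<circ> s y = s y \<circ> s x" if "x \<in> I1" "y \<in> I2" for x y
      using that IJ by (intro comm) (auto simp: defs)
    then obtain a b where ab: "a \<in> ?W I1" "b \<in> ?W I2" "g = a \<circ> b"
      using g Ieq by (metis IntD1 word_split)
    have "s x \<circ> s y = s y \<circ> s x" if "x \<in> J1" "y \<in> J2" for x y
      using that IJ by (intro comm) (auto simp: defs)
    then obtain c d where cd: "c \<in> ?W J1" "d \<in> ?W J2" "g = c \<circ> d"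
      using g Jeq by (metis IntD2 word_split)
    have inv: "s i \<circ> s i = id" if "i \<in> I \<union> J" for i
      using that IJ invol by auto
    obtain c' where c': "c' \<in> ?W J1" "c' \<circ> c = id" "c \<circ> c' = id"
      using word_inverse[OF _ cd(1)] inv Jeq by (metis UnCI)
    obtain b' where b': "b' \<in> ?W I2" "b' \<circ> b = id" "b \<circ> b' = id"
      using word_inverse[OF _ ab(2)] inv Ieq by (metis UnCI)
    \<comment> \<open>The two factorisations of \<open>g\<close> differ by an element \<open>e\<close> of the intersection of the two end
      subgroups; there the set of admissible generators shrinks to \<open>I \<inter> J\<close> between \<open>j\<close> and \<open>k\<close>.\<close>
    define e where "e = c' \<circ> a"
    have "c' \<circ> (a \<circ> b) \<circ> b' = c' \<circ> (c \<circ> d) \<circ> b'" using ab cd by simp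
    then have "(c' \<circ> a) \<circ> (b \<circ> b') = (c' \<circ> c) \<circ> (d \<circ> b')" by (simp only: comp_assoc)
    then have e2: "e = d \<circ> b'" using b' c' by (simp add: e_def)
    have "e \<in> ?W (J1 \<union> I1)"
      unfolding e_def by (intro word_comp word_weaken[OF c'(1)] word_weaken[OF ab(1)]) auto
    moreover have "e \<in> ?W (J2 \<union> I2)"
      unfolding e2 by (intro word_comp word_weaken[OF cd(2)] word_weaken[OF b'(1)]) auto
    moreover have "J1 \<union> I1 \<subseteq> {lo..<hi}" "J2 \<union> I2 \<subseteq> {lo<..hi}"
      using IJ j k by (auto simp: defs)
    ultimately have "e \<in> ?W ((J1 \<union> I1) \<inter> (J2 \<union> I2))" using LR by blast
    moreover have M: "(J1 \<union> I1) \<inter> (J2 \<union> I2) \<subseteq> J1 \<inter> I2"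
      using \<open>j \<le> k\<close> by (auto simp: defs)
    ultimately have e: "e \<in> ?W (J1 \<inter> I2)" using word_mono[OF M] by blast
    obtain e' where e': "e' \<in> ?W (J1 \<inter> I2)" "e' \<circ> e = id" "e \<circ> e' = id"
      using word_inverse[OF _ e] inv Ieq by (metis IntD2 UnCI)
    have "c \<circ> e = a" "d = e \<circ> b"
      unfolding e_def using c' by (simp add: fun_eq_iff, metis ab(3) cd(3) c'(2) comp_assoc id_comp)
    then have c_eq: "c = a \<circ> e'" using e' by (metis comp_assoc comp_id)
    have "I1 \<subseteq> I \<inter> {..<k}" "J1 \<inter> I2 \<subseteq> I \<inter> {..<k}" using \<open>j \<le> k\<close> by (auto simp: defs)
    then have "c \<in> ?W (I \<inter> {..<k})"
      unfolding c_eq by (intro word_comp word_weaken[OF ab(1)] word_weaken[OF e'(1)])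
    moreover have "I \<inter> {..<k} \<subseteq> {lo..<hi}" "J1 \<subseteq> {lo..<hi}" using IJ k by (auto simp: defs)
    ultimately have "c \<in> ?W (I \<inter> {..<k} \<inter> J1)" using cd(1) L by blast
    then have cm: "c \<in> ?W (I \<inter> J)" by (rule word_weaken) (auto simp: defs)
    have "d \<in> ?W I2"
      unfolding \<open>d = e \<circ> b\<close> using ab(2) by (intro word_comp word_weaken[OF e]) auto
    moreover have "I2 \<subseteq> {lo<..hi}" "J2 \<subseteq> {lo<..hi}" using IJ j k by (auto simp: defs)
    ultimately have "d \<in> ?W (I2 \<inter> J2)" using cd(2) R by blast
    then have "d \<in> ?W (I \<inter> J)" by (rule word_weaken) (auto simp: defs)
    with cm show "g \<in> ?W (I \<inter> J)" unfolding cd(3) by (rule word_comp)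
  qed
  have "?W I \<inter> ?W J \<subseteq> ?W (I \<inter> J)" if IJ: "I \<subseteq> {lo..hi}" "J \<subseteq> {lo..hi}" for I J
  proof (cases "I = {lo..hi} \<or> J = {lo..hi}")
    case True
    then have "I \<inter> J = I \<or> I \<inter> J = J" using IJ by blast
    then show ?thesis by auto
  next
    case False
    then obtain j k where jk: "j \<in> {lo..hi}" "j \<notin> I" "k \<in> {lo..hi}" "k \<notin> J"
      using IJ by blast
    show ?thesis
    proof (cases "j \<le> k")
      case True
      then show ?thesis using main[of I J j k] IJ jk by blast
    next
      case False
      then have "k \<le> j" by simp
      then show ?thesis using main[of J I k j] IJ jk by (metis Int_commute)
    qed
  qed
  moreover have "?W (I \<inter> J) \<subseteq> ?W I \<inter> ?W J" for I J
    using word_mono[of "I \<inter> J" I s] word_mono[of "I \<inter> J" J s] by blast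
  ultimately show ?thesis unfolding intersection_property_def by blast
qed

section \<open>The string of four reflections over a field\<close>

type_synonym 'a quad = "'a \<times> 'a \<times> 'a \<times> 'a"

text \<open>
  The last coordinate serves as the default value for indices above \<open>3\<close>.
\<close>

fun coord :: "nat \<Rightarrow> 'a quad \<Rightarrow> 'a" where
  "coord i (x0, x1, x2, x3) = (if i = 0 then x0 else if i = 1 then x1 else if i = 2 then x2 else x3)"

fun scale4 :: "'a::field \<Rightarrow> 'a quad \<Rightarrow> 'a quad" where
  "scale4 k (x0, x1, x2, x3) = (k * x0, k * x1, k * x2, k * x3)"

definition linear4 :: "('a::field quad \<Rightarrow> 'a quad) \<Rightarrow> bool" where
  "linear4 g \<longleftrightarrow> (\<forall>u v. g (u + v) = g u + g v) \<and> (\<forall>k u. g (scale4 k u) = scale4 k (g u))"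

text \<open>
  The reflection \<open>r\<^sub>i\<close> in coordinates with respect to the basic system, where \<open>- a\<close>, \<open>- a'\<close>,
  \<open>- d\<close>, \<open>- d'\<close> are the Cartan integers at the positions \<open>(0,1)\<close>, \<open>(1,0)\<close>, \<open>(2,3)\<close>, \<open>(3,2)\<close>;
  those at \<open>(1,2)\<close> and \<open>(2,1)\<close> are \<open>-1\<close>.
\<close>

fun string_refl :: "'a::field \<Rightarrow> 'a \<Rightarrow> 'a \<Rightarrow> 'a \<Rightarrow> nat \<Rightarrow> 'a quad \<Rightarrow> 'a quad" where
  "string_refl a a' d d' i (x0, x1, x2, x3) =
     (if i = 0 then (a * x1 - x0, x1, x2, x3)
      else if i = 1 then (x0, a' * x0 - x1 + x2, x2, x3)
      else if i = 2 then (x0, x1, x1 - x2 + d * x3, x3)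
      else (x0, x1, x2, d' * x2 - x3))"

lemma quad_eqI:
  assumes "\<And>i. i < 4 \<Longrightarrow> coord i u = coord i v"
  shows "u = v"
  using assms[of 0] assms[of 1] assms[of 2] assms[of 3] by (cases u; cases v) auto

lemma linear4_comb:
  assumes "linear4 g"
  shows "g (scale4 k u + scale4 l v) = scale4 k (g u) + scale4 l (g v)"
  using assms unfolding linear4_def by metis

locale string_group =
  fixes a a' d d' :: "'a::field"
  assumes two: "(2::'a) \<noteq> 0" and aa: "a * a' = 3"
begin

abbreviation r where "r \<equiv> string_refl a a' d d'"
abbreviation W where "W \<equiv> word_maps r"

lemma r_invol: "r i \<circ> r i = id"
  by (auto simp: fun_eq_iff)

lemma r_comm: "i + 2 \<le> j \<Longrightarrow> j < 4 \<Longrightarrow> r i \<circ> r j = r j \<circ> r i"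
  by (auto simp: fun_eq_iff)

lemma r_linear: "linear4 (r i)"
  by (auto simp: linear4_def algebra_simps)

lemma W_linear: "g \<in> W I \<Longrightarrow> linear4 g"
proof (induction rule: word_maps.induct)
  case word_id
  show ?case by (simp add: linear4_def)
next
  case (word_step i g)
  then show ?case using r_linear[of i] unfolding linear4_def comp_apply by metis
qed

text \<open>
  A reflection changes only its own coordinate; this is what separates subgroups on different
  sets of generators.
\<close>

lemma W_coord:
  assumes "g \<in> W I" "I \<subseteq> {..<4}" "i < 4" "i \<notin> I"
  shows "coord i (g v) = coord i v"
  using assms(1)
proof (induction rule: word_maps.induct)
  case (word_step j g)
  have "j < 4" "i \<noteq> j" using word_step assms by auto
  then have "coord i (r j u) = coord i u" for u
    using assms(3) by (cases u) auto
  then show ?case using word_step by simp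
qed simp

lemma W_plane:
  assumes "g \<in> W {1, 2}"
  obtains y1 y2 where "g (0, x1, x2, 0) = (0, y1, y2, 0)"
  using W_coord[OF assms, of 0 "(0, x1, x2, 0)"] W_coord[OF assms, of 3 "(0, x1, x2, 0)"]
  by (cases "g (0, x1, x2, 0)") auto

lemma W_disjoint:
  assumes "I \<subseteq> {..<4}" "J \<subseteq> {..<4}" "I \<inter> J = {}"
  shows "W I \<inter> W J \<subseteq> W {}"
proof
  fix g assume g: "g \<in> W I \<inter> W J"
  have "g v = v" for v
  proof (rule quad_eqI)
    fix i :: nat assume "i < 4"
    moreover have "i \<notin> I \<or> i \<notin> J" using assms by blast
    ultimately show "coord i (g v) = coord i v" using g W_coord assms(1,2) by blast
  qed
  then show "g \<in> W {}" by (auto simp: word_empty fun_eq_iff)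
qed

text \<open>
  The braid relation closes the list: this subgroup is the symmetric group on three letters.
\<close>

lemma W12_elements:
  assumes "g \<in> W {1, 2}"
  shows "g \<in> {id, r 1, r 2, r 1 \<circ> r 2, r 2 \<circ> r 1, r 1 \<circ> r 2 \<circ> r 1}"
  using assms
proof (induction rule: word_maps.induct)
  case (word_step i g)
  have br: "r 2 \<circ> (r 1 \<circ> r 2) = r 1 \<circ> (r 2 \<circ> r 1)" 
    by (auto simp: fun_eq_iff algebra_simps)
  have br2: "r 2 \<circ> (r 1 \<circ> (r 2 \<circ> r 1)) = r 1 \<circ> r 2" 
    by (auto simp: fun_eq_iff algebra_simps)
  have c: "r i \<circ> (r i \<circ> h) = h" for i h using r_invol[of i] by (metis comp_assoc id_comp)
  from word_step(1) have "i = 1 \<or> i = 2" by blast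
  then show ?case
    using word_step(3)
    by (elim disjE insertE emptyE; simp only: comp_assoc c br br2 r_invol comp_id insert_iff simp_thms)
qed simp

text \<open>
  Elements of \<open>W {0, 1}\<close> keep the coordinate \<open>2\<close>, but of the six elements of \<open>W {1, 2}\<close> only
  \<open>id\<close> and \<open>r 1\<close> keep it at the basis vector \<open>b\<^sub>1\<close>.
\<close>

lemma W01_inter_W12: "W {0, 1} \<inter> W {1, 2} \<subseteq> W {1}"
proof
  fix g assume g: "g \<in> W {0, 1} \<inter> W {1, 2}"
  have "coord 2 (g (0, 1, 0, 0)) = 0" using g W_coord[of g "{0, 1}" 2 "(0, 1, 0, 0)"] by simp
  moreover have "g \<in> {id, r 1, r 2, r 1 \<circ> r 2, r 2 \<circ> r 1, r 1 \<circ> r 2 \<circ> r 1}"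
    using g W12_elements by blast
  ultimately have "g = id \<or> g = r 1" by auto
  then show "g \<in> W {1}" by (auto intro: word_id word_gen)
qed

lemma W12_inter_W23: "W {1, 2} \<inter> W {2, 3} \<subseteq> W {2}"
proof
  fix g assume g: "g \<in> W {1, 2} \<inter> W {2, 3}"
  have "coord 1 (g (0, 0, 1, 0)) = 0" using g W_coord[of g "{2, 3}" 1 "(0, 0, 1, 0)"] by simp
  moreover have "g \<in> {id, r 1, r 2, r 1 \<circ> r 2, r 2 \<circ> r 1, r 1 \<circ> r 2 \<circ> r 1}"
    using g W12_elements by blast
  ultimately have "g = id \<or> g = r 2" by auto
  then show "g \<in> W {2}" by (auto intro: word_id word_gen)
qed

lemma interval_step:
  assumes "hi < 4" "intersection_property r {lo..<hi}" "intersection_property r {lo<..hi}"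
    "W {lo..<hi} \<inter> W {lo<..hi} \<subseteq> W {lo<..<hi}"
  shows "intersection_property r {lo..hi}"
  using assms by (intro string_criterion r_invol r_comm) auto

text \<open>
  All smaller intervals satisfy the criterion over any field, so only the step from rank three
  to rank four remains.
\<close>

lemma intersection_property_iff:
  "intersection_property r {..<4} \<longleftrightarrow> W {0, 1, 2} \<inter> W {1, 2, 3} \<subseteq> W {1, 2}"
proof
  assume "intersection_property r {..<4}"
  then have "W {0, 1, 2} \<inter> W {1, 2, 3} = W ({0, 1, 2} \<inter> {1, 2, 3})"
    unfolding intersection_property_def by (elim allE[of _ "{0, 1, 2}"] allE[of _ "{1, 2, 3}"]) auto
  then show "W {0, 1, 2} \<inter> W {1, 2, 3} \<subseteq> W {1, 2}" by auto
next
  assume core: "W {0, 1, 2} \<inter> W {1, 2, 3} \<subseteq> W {1, 2}"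
  have sets: "{0::nat..<1} = {0}" "{1::nat..<2} = {1}" "{2::nat..<3} = {2}"
    "{0::nat<..1} = {1}" "{1::nat<..2} = {2}" "{2::nat<..3} = {3}"
    "{0::nat<..<1} = {}" "{1::nat<..<2} = {}" "{2::nat<..<3} = {}"
    "{0::nat..<2} = {0..1}" "{1::nat..<3} = {1..2}" "{0::nat<..2} = {1..2}" "{1::nat<..3} = {2..3}"
    "{0::nat<..<2} = {1}" "{1::nat<..<3} = {2}"
    "{0::nat..<3} = {0..2}" "{0::nat<..3} = {1..3}" "{0::nat<..<3} = {1,2}" by auto
  have ivl: "{0::nat..1} = {0, 1}" "{1::nat..2} = {1, 2}" "{2::nat..3} = {2, 3}" 
    "{0::nat..2} = {0, 1, 2}" "{1::nat..3} = {1, 2, 3}" "{..<4::nat} = {0..3}" by auto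
  have 2: "intersection_property r {0..1}" "intersection_property r {1..2}"
    "intersection_property r {2..3}"
    by (rule interval_step; simp only: sets intersection_property_single; intro W_disjoint; simp)+
  have lt: "2 < (4::nat)" "3 < (4::nat)" by simp_all
  have inner: "W {0..1} \<inter> W {1..2} \<subseteq> W {1}" "W {1..2} \<inter> W {2..3} \<subseteq> W {2}"
    "W {0..2} \<inter> W {1..3} \<subseteq> W {1, 2}"
    using W01_inter_W12 W12_inter_W23 core by (simp_all only: ivl)
  have 3: "intersection_property r {0..2}" "intersection_property r {1..3}"
    by (rule interval_step; simp only: sets 2 inner lt)+
  have "intersection_property r {0..3}"
    by (rule interval_step; simp only: sets 3 inner lt)
  then show "intersection_property r {..<4}" by (simp only: ivl(6))
qed

section \<open>Intersection of the two end subgroups in characteristic three\<close>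

lemma W_fixed:
  assumes "g \<in> W I" "\<And>i. i \<in> I \<Longrightarrow> r i v = v"
  shows "g v = v"
  using assms by (induction rule: word_maps.induct) auto

text \<open>
  The group \<open>[6,3]\<close> is Euclidean, so its form on the span of \<open>b\<^sub>0, b\<^sub>1, b\<^sub>2\<close> has a radical; this vector is
  the reduction of a spanning vector of it.
\<close>

lemma fixed_012: "g \<in> W {0, 1, 2} \<Longrightarrow> g (a, 2, 1, 0) = (a, 2, 1, 0)"
  by (rule W_fixed) (use aa in \<open>auto simp: algebra_simps\<close>)

text \<open>
  When \<open>d d' = 4\<close> the form on the span of \<open>b\<^sub>1, b\<^sub>2, b\<^sub>3\<close> is nondegenerate, and this vector is
  orthogonal to that span.
\<close>

lemma fixed_123:
  assumes "d * d' = 4" "g \<in> W {1, 2, 3}"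
  shows "g (2, 0, - 2 * a', - a' * d') = (2, 0, - 2 * a', - a' * d')"
proof (rule W_fixed[OF assms(2)])
  have "d * (a' * d') = 4 * a'" using assms(1) by (simp add: mult.left_commute[of d])
  then show "r i (2, 0, - 2 * a', - a' * d') = (2, 0, - 2 * a', - a' * d')" if "i \<in> {1, 2, 3}" for i
    using that by auto
qed

lemma W12_sub: "s \<in> W {1, 2} \<Longrightarrow> s \<in> W {0, 1, 2}" "s \<in> W {1, 2} \<Longrightarrow> s \<in> W {1, 2, 3}"
  by (erule word_weaken, blast)+

text \<open>
  In characteristic three \<open>a'\<close> vanishes if \<open>b\<^sub>0\<close> is the long root of \<open>[6]\<close>.  Then the line of \<open>b\<^sub>0\<close> is
  invariant and \<open>r 0\<close> acts trivially on the quotient, so an element of \<open>W {0, 1, 2}\<close> agrees with one of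
  \<open>W {1, 2}\<close> except in the coordinate \<open>0\<close>; elements of \<open>W {1, 2, 3}\<close> keep that coordinate.
\<close>

lemma long_left:
  assumes "a' = 0"
  shows "W {0, 1, 2} \<inter> W {1, 2, 3} \<subseteq> W {1, 2}"
proof
  fix g assume g: "g \<in> W {0, 1, 2} \<inter> W {1, 2, 3}"
  have "\<exists>s \<in> W {1, 2}. \<forall>v. snd (g v) = snd (s v)" if "g \<in> W {0, 1, 2}" for g
    using that
  proof (induction rule: word_maps.induct)
    case word_id
    show ?case by (intro bexI[of _ id]) (auto intro: word_maps.word_id)
  next
    case (word_step i g)
    then obtain s where s: "s \<in> W {1, 2}" "\<forall>v. snd (g v) = snd (s v)" by blast
    have cong: "snd (r i u) = snd (r i w)" if "snd u = snd w" for u w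
      using that assms by (cases u; cases w) auto
    have drop: "snd (r 0 u) = snd u" for u by (cases u) auto
    show ?case
    proof (cases "i = 0")
      case True
      then have "\<forall>v. snd ((r i \<circ> g) v) = snd (s v)" using s(2) drop unfolding comp_apply by metis
      then show ?thesis using s(1) by blast
    next
      case False
      then have "r i \<circ> s \<in> W {1, 2}" using word_step(1) s by (auto intro: word_maps.word_step)
      moreover have "\<forall>v. snd ((r i \<circ> g) v) = snd ((r i \<circ> s) v)"
        using s(2) cong unfolding comp_apply by metis
      ultimately show ?thesis by blast
    qed
  qed
  then obtain s where s: "s \<in> W {1, 2}" "\<And>v. snd (g v) = snd (s v)" using g by blast
  have "g v = s v" for v
    using W_coord[of g "{1, 2, 3}" 0 v] W_coord[OF s(1), of 0 v] g s(2)[of v]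
    by (cases "g v"; cases "s v") auto
  then show "g \<in> W {1, 2}" using s(1) by (metis ext)
qed

text \<open>
  The mirror image of \<open>long_left\<close>, with \<open>b\<^sub>3\<close> in place of \<open>b\<^sub>0\<close>.
\<close>

lemma long_right:
  assumes "d = 0"
  shows "W {0, 1, 2} \<inter> W {1, 2, 3} \<subseteq> W {1, 2}"
proof
  fix g assume g: "g \<in> W {0, 1, 2} \<inter> W {1, 2, 3}"
  have "\<exists>s \<in> W {1, 2}. \<forall>v. \<forall>i<3. coord i (g v) = coord i (s v)" if "g \<in> W {1, 2, 3}" for g
    using that
  proof (induction rule: word_maps.induct)
    case word_id
    show ?case by (intro bexI[of _ id]) (auto intro: word_maps.word_id)
  next
    case (word_step j g)
    then obtain s where s: "s \<in> W {1, 2}" "\<forall>v. \<forall>i<3. coord i (g v) = coord i (s v)" by blast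
    have cong: "\<forall>i<3. coord i (r j u) = coord i (r j w)" if "\<forall>i<3. coord i u = coord i w" for u w
      using that[rule_format, of 0] that[rule_format, of 1] that[rule_format, of 2] assms
      by (cases u; cases w) auto
    have drop: "\<forall>i<3. coord i (r 3 u) = coord i u" for u by (cases u) auto
    show ?case
    proof (cases "j = 3")
      case True
      then show ?thesis using s drop by (intro bexI[of _ s]) auto
    next
      case False
      then have "r j \<circ> s \<in> W {1, 2}" using word_step(1) s by (auto intro: word_maps.word_step)
      then show ?thesis using s cong by (intro bexI[of _ "r j \<circ> s"]) auto
    qed
  qed
  then obtain s where s: "s \<in> W {1, 2}" "\<And>v i. i < 3 \<Longrightarrow> coord i (g v) = coord i (s v)" using g by blast
  have "g v = s v" for v
  proof (rule quad_eqI)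
    fix i :: nat assume "i < 4"
    then consider "i < 3" | "i = 3" by linarith
    then show "coord i (g v) = coord i (s v)"
      using s W_coord[of g "{0, 1, 2}" 3 v] W_coord[OF s(1), of 3 v] g by cases auto
  qed
  then show "g \<in> W {1, 2}" using s(1) by (metis ext)
qed

text \<open>
  If instead \<open>b\<^sub>0\<close> is the short root, \<open>r 0\<close> fixes the hyperplane of \<open>b\<^sub>1, b\<^sub>2, b\<^sub>3\<close> pointwise, and that
  hyperplane is invariant.
\<close>

lemma short_left:
  assumes "a = 0" "g \<in> W {0, 1, 2}"
  shows "\<exists>s \<in> W {1, 2}. \<forall>x1 x2 x3. g (0, x1, x2, x3) = s (0, x1, x2, x3)"
  using assms(2)
proof (induction rule: word_maps.induct)
  case word_id
  show ?case by (intro bexI[of _ id]) (auto intro: word_maps.word_id)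
next
  case (word_step i g)
  then obtain s where s: "s \<in> W {1, 2}" "\<And>x1 x2 x3. g (0, x1, x2, x3) = s (0, x1, x2, x3)" by blast
  show ?case
  proof (cases "i = 0")
    case True
    have "r 0 (s (0, x1, x2, x3)) = s (0, x1, x2, x3)" for x1 x2 x3
      using W_coord[OF s(1), of 0 "(0, x1, x2, x3)"] assms(1) by (cases "s (0, x1, x2, x3)") auto
    then show ?thesis using s True by (intro bexI[of _ s]) auto
  next
    case False
    then have "r i \<circ> s \<in> W {1, 2}" using word_step(1) s by (auto intro: word_maps.word_step)
    then show ?thesis using s by (intro bexI[of _ "r i \<circ> s"]) auto
  qed
qed

lemma short_right:
  assumes "d' = 0" "g \<in> W {1, 2, 3}"
  shows "\<exists>s \<in> W {1, 2}. \<forall>x0 x1 x2. g (x0, x1, x2, 0) = s (x0, x1, x2, 0)"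
  using assms(2)
proof (induction rule: word_maps.induct)
  case word_id
  show ?case by (intro bexI[of _ id]) (auto intro: word_maps.word_id)
next
  case (word_step i g)
  then obtain s where s: "s \<in> W {1, 2}" "\<And>x0 x1 x2. g (x0, x1, x2, 0) = s (x0, x1, x2, 0)" by blast
  show ?case
  proof (cases "i = 3")
    case True
    have "r 3 (s (x0, x1, x2, 0)) = s (x0, x1, x2, 0)" for x0 x1 x2
      using W_coord[OF s(1), of 3 "(x0, x1, x2, 0)"] assms(1) by (cases "s (x0, x1, x2, 0)") auto
    then show ?thesis using s True by (intro bexI[of _ s]) auto
  next
    case False
    then have "r i \<circ> s \<in> W {1, 2}" using word_step(1) s by (auto intro: word_maps.word_step)
    then show ?thesis using s by (intro bexI[of _ "r i \<circ> s"]) auto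
  qed
qed

lemma W12_faithful:
  assumes "s \<in> W {1, 2}" "s (0, 1, 0, 0) = (0, 1, 0, 0)" "s (0, 0, 1, 0) = (0, 0, 1, 0)"
  shows "s = id"
  using W12_elements[OF assms(1)] assms(2,3) by auto

lemma W12_not_minus:
  assumes "s \<in> W {1, 2}" "s (0, 1, 0, 0) = (0, -1, 0, 0)" "s (0, 0, 1, 0) = (0, 0, -1, 0)"
  shows False
proof -
  have "(1::'a) \<noteq> -1"
    using two by (metis add.right_inverse one_add_one)
  then show False
    using W12_elements[OF assms(1)] assms(2,3) by auto
qed

text \<open>
  A common element agrees on each of the two coordinate hyperplanes with an element of \<open>W {1, 2}\<close>.
  These two elements agree on the plane of \<open>b\<^sub>1, b\<^sub>2\<close>, hence coincide.
\<close>

lemma two_short: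
  assumes "a = 0" "d' = 0"
  shows "W {0, 1, 2} \<inter> W {1, 2, 3} \<subseteq> W {1, 2}"
proof
  fix g assume g: "g \<in> W {0, 1, 2} \<inter> W {1, 2, 3}"
  obtain s where s: "s \<in> W {1, 2}" "\<And>x1 x2 x3. g (0, x1, x2, x3) = s (0, x1, x2, x3)"
    using short_left[OF assms(1)] g by blast
  obtain t where t: "t \<in> W {1, 2}" "\<And>x0 x1 x2. g (x0, x1, x2, 0) = t (x0, x1, x2, 0)"
    using short_right[OF assms(2)] g by blast
  obtain s' where s': "s' \<in> W {1, 2}" "s' \<circ> s = id" "s \<circ> s' = id"
    using word_inverse[OF r_invol s(1)] by blast
  have "s' \<circ> t = id"
    using s t s' by (intro W12_faithful word_comp) (metis comp_apply id_apply)+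
  then have "t = s" using s' by (metis comp_assoc comp_id id_comp)
  have "g (x0, x1, x2, x3) = s (x0, x1, x2, x3)" for x0 x1 x2 x3
  proof -
    have v: "(x0, x1, x2, x3) = (x0, x1, x2, 0) + (0, 0, 0, x3)" by simp
    have "g ((x0, x1, x2, 0) + (0, 0, 0, x3)) = s ((x0, x1, x2, 0) + (0, 0, 0, x3))"
      using W_linear[of g] W_linear[OF s(1)] g s(2) t(2) \<open>t = s\<close>
      unfolding linear4_def by (metis IntD1)
    then show ?thesis by simp
  qed
  then have "g = s" by auto
  then show "g \<in> W {1, 2}" using s(1) by simp
qed

text \<open>
  After division by an element of \<open>W {1, 2}\<close>, a common element fixes the hyperplane of \<open>b\<^sub>1, b\<^sub>2, b\<^sub>3\<close>
  pointwise, and it also fixes the vector of \<open>fixed_123\<close>, which lies outside that hyperplane.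
\<close>

lemma short_nondegenerate:
  assumes "a = 0" "d * d' = 4"
  shows "W {0, 1, 2} \<inter> W {1, 2, 3} \<subseteq> W {1, 2}"
proof
  fix g assume g: "g \<in> W {0, 1, 2} \<inter> W {1, 2, 3}"
  obtain s where s: "s \<in> W {1, 2}" "\<And>x1 x2 x3. g (0, x1, x2, x3) = s (0, x1, x2, x3)"
    using short_left[OF assms(1)] g by blast
  obtain s' where s': "s' \<in> W {1, 2}" "s' \<circ> s = id" "s \<circ> s' = id"
    using word_inverse[OF r_invol s(1)] by blast
  define h where "h = s' \<circ> g"
  have h: "h \<in> W {1, 2, 3}" using s' g W12_sub by (auto simp: h_def intro: word_comp)
  let ?e = "(2, 0, - 2 * a', - a' * d')"
  have "h (0, x1, x2, x3) = (0, x1, x2, x3)" for x1 x2 x3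
    using s s' by (metis comp_apply h_def id_apply)
  moreover have "h ?e = ?e" using fixed_123[OF assms(2) h] .
  ultimately have comb: "h (scale4 k ?e + scale4 1 (0, x1, x2, x3)) = scale4 k ?e + scale4 1 (0, x1, x2, x3)"
    for k x1 x2 x3
    using linear4_comb[OF W_linear[OF h]] by metis
  have "h (x0, x1, x2, x3) = (x0, x1, x2, x3)" for x0 x1 x2 x3
    using comb[of "x0 / 2" x1 "x2 + x0 * a'" "x3 + x0 / 2 * (a' * d')"] two by (simp add: algebra_simps)
  then have "h = id" by auto
  then have "g = s" using s' unfolding h_def by (metis comp_assoc comp_id id_comp)
  then show "g \<in> W {1, 2}" using s(1) by simp
qed

section \<open>Intersection of the two end subgroups when three is not a square\<close>

text \<open>
  On the span of \<open>b\<^sub>0, b\<^sub>1, b\<^sub>2\<close> modulo the vector of \<open>fixed_012\<close>, the reflection \<open>r 0\<close> equals \<open>- r 2\<close>, so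
  the group acts there as \<open>W {1, 2}\<close> up to sign.
\<close>

lemma point_group:
  assumes "g \<in> W {0, 1, 2}"
  shows "\<exists>\<epsilon>\<in>{1, -1}. \<exists>s \<in> W {1, 2}. \<forall>x1 x2. \<exists>k.
    g (0, x1, x2, 0) = scale4 \<epsilon> (s (0, x1, x2, 0)) + scale4 k (a, 2, 1, 0)"
  using assms
proof (induction rule: word_maps.induct)
  case word_id
  have "id (0, x1, x2, 0) = scale4 1 (id (0, x1, x2, 0)) + scale4 0 (a, 2, 1, 0)" for x1 x2 by simp
  then show ?case using word_maps.word_id[of r] by blast
next
  case (word_step i g)
  then obtain \<epsilon> s where \<epsilon>: "\<epsilon> \<in> {1, -1}" and s: "s \<in> W {1, 2}" 
    and ex: "\<forall>x1 x2. \<exists>k. g (0, x1, x2, 0) = scale4 \<epsilon> (s (0, x1, x2, 0)) + scale4 k (a, 2, 1, 0)"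
    by blast
  show ?case
  proof (cases "i = 0")
    case True
    \<comment> \<open>Modulo the fixed vector, \<open>r 0\<close> is \<open>- r 2\<close>.\<close>
    have "\<exists>k. (r 0 \<circ> g) (0, x1, x2, 0) = scale4 (- \<epsilon>) ((r 2 \<circ> s) (0, x1, x2, 0)) + scale4 k (a, 2, 1, 0)"
      for x1 x2
    proof -
      obtain k where k: "g (0, x1, x2, 0) = scale4 \<epsilon> (s (0, x1, x2, 0)) + scale4 k (a, 2, 1, 0)"
        using ex by blast
      obtain y1 y2 where y: "s (0, x1, x2, 0) = (0, y1, y2, 0)" using W_plane[OF s] by blast
      show ?thesis using k y
        by (intro exI[of _ "\<epsilon> * y1 + k"]) (auto simp: algebra_simps)
    qed
    moreover have "- \<epsilon> \<in> {1, -1}" using \<epsilon> by auto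
    moreover have "r 2 \<circ> s \<in> W {1, 2}" using s by (intro word_maps.word_step) auto
    ultimately show ?thesis unfolding True by blast
  next
    case False
    have "(r i \<circ> g) (0, x1, x2, 0) = scale4 \<epsilon> ((r i \<circ> s) (0, x1, x2, 0)) + scale4 k (a, 2, 1, 0)"
      if "g (0, x1, x2, 0) = scale4 \<epsilon> (s (0, x1, x2, 0)) + scale4 k (a, 2, 1, 0)" for x1 x2 k
      unfolding comp_apply that linear4_comb[OF r_linear]
      using fixed_012[OF word_gen[of i]] word_step(1) by metis
    moreover have "r i \<circ> s \<in> W {1, 2}" using s word_step(1) False by (intro word_maps.word_step) auto
    ultimately show ?thesis using \<epsilon> ex by meson
  qed
qed

text \<open>
  Under the isomorphism from the span of \<open>b\<^sub>1, b\<^sub>2, b\<^sub>3\<close> to binary quadratic forms, \<open>b\<^sub>1\<close> goes to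
  \<open>Y\<^sup>2 - X\<^sup>2\<close>, \<open>b\<^sub>2\<close> to \<open>X\<^sup>2 - 2 X Y\<close> and \<open>b\<^sub>3\<close> to \<open>d X Y\<close>; up to a factor, the invariant quadratic form
  becomes the discriminant.
\<close>

definition binary_form :: "'a quad \<Rightarrow> 'a \<Rightarrow> 'a \<Rightarrow> 'a" where
  "binary_form v X Y = (case v of (x0, x1, x2, x3) \<Rightarrow>
     (x2 - x1) * X\<^sup>2 + (d * x3 - 2 * x2) * X * Y + x1 * Y\<^sup>2)"

text \<open>
  The generators \<open>r 1\<close>, \<open>r 2\<close>, \<open>r 3\<close> exchange \<open>X\<close> and \<open>Y\<close>, replace \<open>Y\<close> by \<open>X - Y\<close>, and replace \<open>Y\<close>
  by \<open>- Y\<close>.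
\<close>

lemma substitution:
  assumes "d * d' = 4" "g \<in> W {1, 2, 3}"
  shows "\<exists>p q t u. \<forall>x1 x2 x3 X Y.
    binary_form (g (0, x1, x2, x3)) X Y = binary_form (0, x1, x2, x3) (p * X + q * Y) (t * X + u * Y)"
  using assms(2)
proof (induction rule: word_maps.induct)
  case word_id
  show ?case by (intro exI[of _ 1] exI[of _ 0]) simp
next
  case (word_step i g)
  then obtain p q t u where IH: "\<And>x1 x2 x3 X Y. binary_form (g (0, x1, x2, x3)) X Y =
    binary_form (0, x1, x2, x3) (p * X + q * Y) (t * X + u * Y)" by blast
  have g0: "\<exists>y1 y2 y3. g (0, x1, x2, x3) = (0, y1, y2, y3)" for x1 x2 x3
    using W_coord[OF word_step(2), of 0 "(0, x1, x2, x3)"] by (cases "g (0, x1, x2, x3)") auto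
  have compose: ?case
    if "\<And>y1 y2 y3 X Y. binary_form (r i (0, y1, y2, y3)) X Y
      = binary_form (0, y1, y2, y3) (k * X + l * Y) (m * X + n * Y)" for k l m n
  proof (intro exI allI)
    fix x1 x2 x3 X Y
    obtain y1 y2 y3 where y: "g (0, x1, x2, x3) = (0, y1, y2, y3)" using g0 by blast
    have "binary_form ((r i \<circ> g) (0, x1, x2, x3)) X Y
      = binary_form (g (0, x1, x2, x3)) (k * X + l * Y) (m * X + n * Y)"
      using that y by simp
    also have "\<dots> = binary_form (0, x1, x2, x3) ((p * k + q * m) * X + (p * l + q * n) * Y)
      ((t * k + u * m) * X + (t * l + u * n) * Y)"
      unfolding IH by (simp add: algebra_simps)
    finally show "binary_form ((r i \<circ> g) (0, x1, x2, x3)) X Y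
      = binary_form (0, x1, x2, x3) ((p * k + q * m) * X + (p * l + q * n) * Y)
      ((t * k + u * m) * X + (t * l + u * n) * Y)" .
  qed
  from word_step(1) consider "i = 1" | "i = 2" | "i = 3" by blast
  then show ?case
  proof cases
    case 1
    show ?thesis
      by (rule compose[of 0 1 1 0]) (simp add: 1 binary_form_def algebra_simps)
  next
    case 2
    show ?thesis
      by (rule compose[of 1 0 1 "-1"]) (simp add: 2 binary_form_def power2_eq_square algebra_simps)
  next
    case 3
    have "d * (d' * x) = 4 * x" for x using assms(1) by (simp flip: mult.assoc)
    then show ?thesis
      by (intro compose[of 1 0 0 "-1"]) (simp add: 3 binary_form_def algebra_simps)
  qed
qed

text \<open>
  The substitution of an element that is \<open>-1\<close> on the plane of \<open>b\<^sub>1, b\<^sub>2\<close> negates the forms \<open>Y\<^sup>2 - X\<^sup>2\<close>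
  and \<open>X\<^sup>2 - 2 X Y\<close>.  Comparing coefficients leaves a scalar substitution, which would negate \<open>b\<^sub>3\<close> too
  and is excluded by the last hypothesis, or one with \<open>3 u\<^sup>2 = 1\<close>.
\<close>

lemma half_turn_square:
  assumes "d * d' = 4" "g \<in> W {1, 2, 3}"
    and minus: "g (0, 1, 0, 0) = (0, -1, 0, 0)" "g (0, 0, 1, 0) = (0, 0, -1, 0)"
    and b3: "coord 3 (g (0, 0, 0, 1)) = 1"
  shows "\<exists>t::'a. t\<^sup>2 = 3"
proof -
  obtain p q t u where sub: "\<And>x1 x2 x3 X Y. binary_form (g (0, x1, x2, x3)) X Y =
    binary_form (0, x1, x2, x3) (p * X + q * Y) (t * X + u * Y)"
    using substitution[OF assms(1,2)] by blast
  have "coord 0 (g (0, 0, 0, 1)) = 0" using W_coord[OF assms(2), of 0 "(0, 0, 0, 1)"] by simp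
  then obtain w1 w2 where w: "g (0, 0, 0, 1) = (0, w1, w2, 1)"
    using b3 by (cases "g (0, 0, 0, 1)") auto
  note A = sub[of 1 0 0, unfolded minus binary_form_def, simplified]
  note B = sub[of 0 1 0, unfolded minus binary_form_def, simplified]
  note C = sub[of 0 0 1, unfolded w binary_form_def, simplified]
  have A1: "t\<^sup>2 - p\<^sup>2 = 1" using A[of 1 0, simplified] by (simp add: algebra_simps)
  have A2: "u\<^sup>2 - q\<^sup>2 = -1" using A[of 0 1, simplified] by (simp add: algebra_simps)
  have A3: "t * u = p * q"
  proof -
    have "2 * (t * u - p * q) = 0" using A[of 1 1, simplified] A1 A2 by Groebner_Basis.algebra
    then show ?thesis using two by simp
  qed
  have B1: "p\<^sup>2 - 2 * p * t = -1" using B[of 1 0, simplified] by (simp add: algebra_simps)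
  have B2: "q * (q - 2 * u) = 0" using B[of 0 1, simplified] by (simp add: algebra_simps power2_eq_square)
  have B3: "p * q - p * u - q * t = 1"
  proof -
    have "2 * (p * q - p * u - q * t) = 2 * 1" using B[of 1 1, simplified] B1 B2 by Groebner_Basis.algebra
    then show ?thesis using two unfolding mult_cancel_left by blast
  qed
  have C1: "d * p * t = w2 - w1" using C[of 1 0, simplified] by (simp add: algebra_simps)
  have C2: "d * q * u = w1" using C[of 0 1, simplified] by (simp add: algebra_simps)
  have C3: "d * (p * u + q * t + 2 * p * t + 2 * q * u - 1) = 0"
    using C[of 1 1, simplified] C1 C2 by Groebner_Basis.algebra
  have "d \<noteq> 0"
  proof
    assume "d = 0"
    then have "(2::'a) * 2 = 0" using assms(1) by simp
    then show False using two by (metis mult_eq_0_iff)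
  qed
  then have C4: "p * u + q * t + 2 * p * t + 2 * q * u = 1" using C3 by simp
  from B2 consider "q = 0" | "q = 2 * u" by auto
  then show ?thesis
  proof cases
    case 1
    then have "u \<noteq> 0" using A2 by auto
    then have "t = 0" using A3 1 by simp
    then have "p * u = 1" "- (p * u) = 1" using B3 C4 1 by simp_all
    then have "(2::'a) = 0" by (metis add.right_inverse one_add_one)
    then show ?thesis using two by simp
  next
    case 2
    then have "3 * u\<^sup>2 = 1" using A2 by Groebner_Basis.algebra
    then have "(3 * u)\<^sup>2 = 3" by Groebner_Basis.algebra
    then show ?thesis by blast
  qed
qed

text \<open>
  By \<open>point_group\<close>, a common element can be divided by an element of \<open>W {1, 2}\<close> so that it becomes
  \<open>1\<close> or \<open>-1\<close> on the plane of \<open>b\<^sub>1, b\<^sub>2\<close>.  In the first case it fixes that plane and the vectors of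
  \<open>fixed_012\<close> and \<open>fixed_123\<close>, which together span the space; the second is excluded by
  \<open>half_turn_square\<close>.
\<close>

lemma ends_inter_nonsquare:
  assumes dd: "d * d' = 4" and three: "(3::'a) \<noteq> 0" and nonsq: "\<nexists>t::'a. t\<^sup>2 = 3"
  shows "W {0, 1, 2} \<inter> W {1, 2, 3} \<subseteq> W {1, 2}"
proof
  fix g assume g: "g \<in> W {0, 1, 2} \<inter> W {1, 2, 3}"
  have nz: "a \<noteq> 0" "a' \<noteq> 0" using aa three by auto
  have "d' \<noteq> 0"
  proof
    assume "d' = 0"
    then have "(2::'a) * 2 = 0" using dd by simp
    then show False using two by (metis mult_eq_0_iff)
  qed
  obtain \<epsilon> s where \<epsilon>: "\<epsilon> \<in> {1, -1}" and s: "s \<in> W {1, 2}" 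
    and ex: "\<And>x1 x2. \<exists>k. g (0, x1, x2, 0) = scale4 \<epsilon> (s (0, x1, x2, 0)) + scale4 k (a, 2, 1, 0)"
    using point_group g by blast
  obtain s' where s': "s' \<in> W {1, 2}" "s' \<circ> s = id" "s \<circ> s' = id"
    using word_inverse[OF r_invol s(1)] by blast
  define h where "h = s' \<circ> g"
  have h012: "h \<in> W {0, 1, 2}" and h123: "h \<in> W {1, 2, 3}"
    using s' g W12_sub by (auto simp: h_def intro: word_comp)
  have h: "h (0, x1, x2, 0) = (0, \<epsilon> * x1, \<epsilon> * x2, 0)" for x1 x2
  proof -
    obtain k where k: "g (0, x1, x2, 0) = scale4 \<epsilon> (s (0, x1, x2, 0)) + scale4 k (a, 2, 1, 0)"
      using ex by blast
    obtain y1 y2 where y: "s (0, x1, x2, 0) = (0, y1, y2, 0)" using W_plane[OF s] by blast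
    have "coord 0 (g (0, x1, x2, 0)) = 0" using g W_coord[of g "{1, 2, 3}" 0 "(0, x1, x2, 0)"] by simp
    then have "k = 0" using k y nz by simp
    then have "g (0, x1, x2, 0) = scale4 \<epsilon> (s (0, x1, x2, 0))" using k y by simp
    then have "h (0, x1, x2, 0) = scale4 \<epsilon> (s' (s (0, x1, x2, 0)))"
      using W_linear[OF s'(1)] unfolding h_def linear4_def by (metis comp_apply)
    also have "s' (s (0, x1, x2, 0)) = (0, x1, x2, 0)" using s' by (metis comp_apply id_apply)
    finally show ?thesis by simp
  qed
  from \<epsilon> consider "\<epsilon> = 1" | "\<epsilon> = -1" by blast
  then show "g \<in> W {1, 2}"
  proof cases
    case 1
    let ?c = "(a, 2, 1, 0)" and ?e = "(2, 0, - 2 * a', - a' * d')"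
    note lin = linear4_comb[OF W_linear[OF h012]]
    have e: "h ?e = ?e" and c: "h ?c = ?c" using fixed_123[OF dd h123] fixed_012[OF h012] by auto
    have ce: "h (scale4 k ?c + scale4 l ?e) = scale4 k ?c + scale4 l ?e" for k l
      unfolding lin e c ..
    have "h (scale4 1 (scale4 k ?c + scale4 l ?e) + scale4 1 (0, x1, x2, 0))
      = scale4 1 (scale4 k ?c + scale4 l ?e) + scale4 1 (0, x1, x2, 0)" for k l x1 x2
      unfolding lin[of 1 "scale4 k ?c + scale4 l ?e" 1 "(0, x1, x2, 0)"] ce h 1 by simp
    note comb = this
    have "h (x0, x1, x2, x3) = (x0, x1, x2, x3)" for x0 x1 x2 x3
    proof -
      define l where "l = - x3 / (a' * d')"
      define k where "k = (x0 - 2 * l) / a"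
      have "l * (a' * d') = - x3" "k * a = x0 - 2 * l" using nz \<open>d' \<noteq> 0\<close> by (simp_all add: l_def k_def)
      then have "scale4 1 (scale4 k ?c + scale4 l ?e) + scale4 1 (0, x1 - 2 * k, x2 - k + 2 * l * a', 0)
        = (x0, x1, x2, x3)" by (simp add: algebra_simps)
      then show ?thesis using comb by metis
    qed
    then have "h = id" by auto
    then have "g = s" using s' unfolding h_def by (metis comp_assoc comp_id id_comp)
    then show ?thesis using s by simp
  next
    case 2
    have "\<exists>t::'a. t\<^sup>2 = 3"
      using half_turn_square[OF dd h123] h[of 1 0] h[of 0 1] W_coord[OF h012, of 3 "(0, 0, 0, 1)"] 2 by simp
    then show ?thesis using nonsq by blast
  qed
qed

end

section \<open>The common half-turn of the two end subgroups\<close>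

text \<open>
  Over a prime field a one-parameter group is cyclic, so a single member with nonzero parameter puts
  all of it in the group, including the members with fractional parameter.
\<close>

lemma word_one_parameter:
  fixes F :: "'a::field \<Rightarrow> 'v \<Rightarrow> 'v"
  assumes prime_field: "\<And>x::'a. \<exists>n. x = of_nat n"
    and zero: "F 0 = id" and add: "\<And>k l. F (k + l) = F k \<circ> F l"
    and gen: "F c \<in> word_maps s I" and "c \<noteq> 0"
  shows "F k \<in> word_maps s I"
proof -
  have mult: "F (of_nat n * c) \<in> word_maps s I" for n
  proof (induction n)
    case 0
    show ?case using zero word_id by (metis mult_zero_left of_nat_0)
  next
    case (Suc n)
    have "F (of_nat (Suc n) * c) = F c \<circ> F (of_nat n * c)"
      by (simp add: distrib_right add)
    then show ?case using word_comp[OF gen Suc] by (simp only:)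
  qed
  obtain n where "k / c = of_nat n" using prime_field by blast
  then show ?thesis using mult[of n] \<open>c \<noteq> 0\<close> by (metis nonzero_divide_eq_eq)
qed

fun reverse4 :: "'a quad \<Rightarrow> 'a quad" where
  "reverse4 (x0, x1, x2, x3) = (x3, x2, x1, x0)"

lemma reverse4_reverse4 [simp]: "reverse4 (reverse4 v) = v"
  by (cases v) simp

text \<open>
  Reversal of the string; for \<open>[6,3,6]\<close> it exchanges the two end subgroups.
\<close>

lemma word_reverse:
  assumes "g \<in> word_maps (string_refl a a' d d') I" "I \<subseteq> {..<4}"
  shows "reverse4 \<circ> g \<circ> reverse4 \<in> word_maps (string_refl d' d a' a) ((\<lambda>i. 3 - i) ` I)"
  using assms(1)
proof (induction rule: word_maps.induct)
  case word_id
  have "reverse4 \<circ> id \<circ> reverse4 = (id :: 'a quad \<Rightarrow> 'a quad)" by (rule ext) simp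
  then show ?case by (simp only: word_maps.word_id)
next
  case (word_step i g)
  have "i < 4" using word_step(1) assms(2) by auto
  then have "reverse4 (string_refl a a' d d' i (reverse4 v)) = string_refl d' d a' a (3 - i) v" for v
    by (cases v) auto
  then have "reverse4 \<circ> (string_refl a a' d d' i \<circ> g) \<circ> reverse4
    = string_refl d' d a' a (3 - i) \<circ> (reverse4 \<circ> g \<circ> reverse4)"
    unfolding fun_eq_iff comp_apply by (metis reverse4_reverse4)
  then show ?case
    using word_maps.word_step[OF imageI[OF word_step(1)] word_step(3)] by (simp only:)
qed

text \<open>
  When \<open>3\<close> is invertible: the map that is \<open>-1\<close> on the plane of \<open>b\<^sub>1, b\<^sub>2\<close> and fixes the vector of \<open>fixed_012\<close>, and, if \<open>d d' = 4\<close>,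
  the one of \<open>fixed_123\<close>, or, if \<open>d d' = 3\<close>, the mirror image of the former.
\<close>

fun half_turn :: "'a::field \<Rightarrow> 'a \<Rightarrow> 'a quad \<Rightarrow> 'a quad" where
  "half_turn a' d (x0, x1, x2, x3) =
     (x0, (4 * a' * x0 + 2 * d * x3) / 3 - x1, (2 * a' * x0 + 4 * d * x3) / 3 - x2, x3)"

text \<open>
  The effect on coordinates of the substitution \<open>Y \<mapsto> Y + k X\<close> in \<open>binary_form\<close>; \<open>e\<close> stands for
  \<open>d' / 2\<close>.
\<close>

fun shear :: "'a::field \<Rightarrow> 'a \<Rightarrow> 'a \<Rightarrow> 'a quad \<Rightarrow> 'a quad" where
  "shear d e k (x0, x1, x2, x3) =
     (x0, x1, x2 + k * (d * x3 - 2 * x2) + k\<^sup>2 * x1,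
      x3 + e * (k * x1 + k * (d * x3 - 2 * x2) + k\<^sup>2 * x1))"

lemma shear_zero: "shear d e 0 = id"
  by (auto simp: fun_eq_iff)

lemma shear_add:
  fixes d e :: "'a::field"
  assumes "d * e = 2"
  shows "shear d e (k + l) = shear d e k \<circ> shear d e l"
proof
  have de: "d * (e * x) = 2 * x" for x
    using assms by (simp flip: mult.assoc)
  fix v show "shear d e (k + l) v = (shear d e k \<circ> shear d e l) v"
    by (cases v) (simp add: de power2_eq_square algebra_simps)
qed

context string_group
begin

text \<open>
  The reduced translation in the direction \<open>k (b\<^sub>1 + 2 b\<^sub>2)\<close>, which is orthogonal to \<open>b\<^sub>1\<close>.  On all of
  the space such a translation is the Siegel transformation
  \<open>v \<mapsto> v + (v\<cdot>c) e - (v\<cdot>e) c - (e\<cdot>e)/2 (v\<cdot>c) c\<close> with \<open>e = k (b\<^sub>1 + 2 b\<^sub>2)\<close> and \<open>c\<close> the vector of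
  \<open>fixed_012\<close>, in the normalisation \<open>b\<^sub>1\<cdot>b\<^sub>1 = 2\<close>; this is where the quadratic term comes from.
\<close>

fun translation :: "'a \<Rightarrow> 'a quad \<Rightarrow> 'a quad" where
  "translation k (x0, x1, x2, x3) =
     (let m = k * (a' * x0 - 3 * x2 + 2 * d * x3) + 3 * k\<^sup>2 * d * x3
      in (x0 + m * a, x1 - k * d * x3 + 2 * m, x2 - 2 * k * d * x3 + m, x3))"

lemma aa_left: "a' * (a * x) = 3 * x"
  using aa by (simp flip: mult.assoc add: mult.commute[of a'])

lemma aa_left': "a * (a' * x) = 3 * x"
  using aa by (simp flip: mult.assoc)

lemma translation_add: "translation (k + l) = translation k \<circ> translation l"
proof
  fix v show "translation (k + l) v = (translation k \<circ> translation l) v"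
    using aa by (cases v) (simp add: Let_def power2_eq_square algebra_simps aa_left aa_left')
qed

lemma translation_zero: "translation 0 = id"
  by (auto simp: fun_eq_iff)

lemma half_turn_01: "(r 0 \<circ> r 1 \<circ> r 0 \<circ> r 1 \<circ> r 0 \<circ> r 1) (x0, x1, x2, x3)
  = (2 * a * x2 - x0, 4 * x2 - x1, x2, x3)"
  using aa by (simp add: algebra_simps aa_left aa_left')

text \<open>
  The half-turn \<open>h = (r\<^sub>0 r\<^sub>1)\<^sup>3\<close> is a translation by some \<open>f\<close> times the central half-turn, and its conjugates
  under the threefold rotation have the rotated vectors \<open>f'\<close>, \<open>f''\<close> with \<open>f + f' + f'' = 0\<close>.  The product
  of four of them below is the translation by \<open>(f - f') + (f - f'') = 3 f\<close>.
\<close>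

lemma translation_word: "translation 2 \<in> W {0, 1, 2}"
proof -
  define h where "h = r 0 \<circ> r 1 \<circ> r 0 \<circ> r 1 \<circ> r 0 \<circ> r 1"
  define h' where "h' = r 2 \<circ> h \<circ> r 2"
  define h'' where "h'' = r 1 \<circ> h' \<circ> r 1"
  have h: "h (x0, x1, x2, x3) = (2 * a * x2 - x0, 4 * x2 - x1, x2, x3)" for x0 x1 x2 x3
    unfolding h_def by (rule half_turn_01)
  have h': "h' (x0, x1, x2, x3) = (2 * a * (x1 - x2 + d * x3) - x0, 3 * x1 - 4 * x2 + 4 * d * x3,
     2 * x1 - 3 * x2 + 4 * d * x3, x3)" for x0 x1 x2 x3
    by (simp add: h'_def h algebra_simps)
  have h'': "h'' v = r 1 (h' (r 1 v))" for v by (simp add: h''_def)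
  have "translation 2 v = (h \<circ> h' \<circ> h \<circ> h'') v" for v
    using aa by (cases v) (simp add: h h' h'' Let_def power2_eq_square algebra_simps aa_left aa_left')
  then have "translation 2 = h \<circ> h' \<circ> h \<circ> h''" by blast
  also have "\<dots> \<in> W {0, 1, 2}"
    unfolding h''_def h'_def h_def by (intro word_comp word_gen) auto
  finally show ?thesis .
qed

text \<open>
  Here \<open>h = (r\<^sub>0 r\<^sub>1)\<^sup>3\<close> is corrected by the translation by \<open>- f\<close>, where \<open>f\<close> has parameter \<open>2 / 3\<close>; it is
  a power of the translation by \<open>3 f\<close> because \<open>3\<close> is invertible.
\<close>

lemma half_turn_012:
  assumes prime_field: "\<And>x::'a. \<exists>n. x = of_nat n" and three: "(3::'a) \<noteq> 0"
  shows "half_turn a' d \<in> W {0, 1, 2}"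
proof -
  let ?h = "r 0 \<circ> r 1 \<circ> r 0 \<circ> r 1 \<circ> r 0 \<circ> r 1"
  have "half_turn a' d v = translation (- (2 / 3)) (?h v)" for v
  proof -
    obtain x0 x1 x2 x3 where v: "v = (x0, x1, x2, x3)" by (cases v)
    \<comment> \<open>Multiples of \<open>3\<close> as coordinates make all denominators disappear.\<close>
    obtain y0 y2 y3 where y: "x0 = 3 * y0" "x2 = 3 * y2" "x3 = 3 * y3"
      using three by (metis nonzero_mult_div_cancel_left times_divide_eq_right)
    define k where "k = - (2 / (3::'a))"
    have k: "k * (3 * x) = - 2 * x" for x using three by (simp add: k_def)
    have "k * (a' * (2 * a * (3 * y2) - 3 * y0) - 3 * (3 * y2) + 2 * d * (3 * y3)) + 3 * k\<^sup>2 * d * (3 * y3)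
      = k * (3 * (3 * y2 - a' * y0 + 2 * d * y3)) + k * (3 * (d * (k * (3 * y3))))"
      by (simp add: power2_eq_square algebra_simps aa_left aa_left')
    also have "\<dots> = 2 * (a' * y0) - 6 * y2" unfolding k by (simp add: algebra_simps)
    finally have m: "k * (a' * (2 * a * (3 * y2) - 3 * y0) - 3 * (3 * y2) + 2 * d * (3 * y3))
      + 3 * k\<^sup>2 * d * (3 * y3) = 2 * (a' * y0) - 6 * y2" .
    have kd: "k * d * (3 * y3) = - 2 * (d * y3)" "2 * k * d * (3 * y3) = - 4 * (d * y3)"
      using k[of "d * y3"] k[of "2 * (d * y3)"] by (simp_all add: algebra_simps)
    have "4 * a' * (3 * y0) + 2 * d * (3 * y3) = 3 * (4 * (a' * y0) + 2 * (d * y3))"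
      "2 * a' * (3 * y0) + 4 * d * (3 * y3) = 3 * (2 * (a' * y0) + 4 * (d * y3))"
      by (simp_all add: algebra_simps)
    then have div3: "(4 * a' * (3 * y0) + 2 * d * (3 * y3)) / 3 = 4 * (a' * y0) + 2 * (d * y3)"
      "(2 * a' * (3 * y0) + 4 * d * (3 * y3)) / 3 = 2 * (a' * y0) + 4 * (d * y3)"
      using three by simp_all
    show ?thesis
      unfolding v half_turn_01 k_def[symmetric] y half_turn.simps translation.simps Let_def m kd div3
      by (simp add: algebra_simps aa_left')
  qed
  then have "half_turn a' d = translation (- (2 / 3)) \<circ> ?h" by auto
  also have "translation (- (2 / 3)) \<in> W {0, 1, 2}"
    using word_one_parameter[OF prime_field translation_zero translation_add translation_word two] .
  then have "translation (- (2 / 3)) \<circ> ?h \<in> W {0, 1, 2}"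
    by (intro word_comp word_gen) auto
  finally show ?thesis .
qed

lemma half_turn_not_12: "half_turn a' d \<notin> W {1, 2}"
  using W12_not_minus[of "half_turn a' d"] by auto

lemma half_turn_123_euclidean:
  assumes prime_field: "\<And>x::'a. \<exists>n. x = of_nat n" and three: "(3::'a) \<noteq> 0" and "d * d' = 3"
  shows "half_turn a' d \<in> W {1, 2, 3}"
proof -
  interpret rev: string_group d' d a' a
    using two assms(3) by unfold_locales (simp_all add: mult.commute)
  have "reverse4 \<circ> half_turn d a' \<circ> reverse4 \<in> W ((\<lambda>i. 3 - i) ` {0, 1, 2})"
    using rev.half_turn_012[OF prime_field three] by (rule word_reverse) auto
  moreover have "reverse4 \<circ> half_turn d a' \<circ> reverse4 = half_turn a' d"
    by (auto simp: fun_eq_iff algebra_simps)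
  moreover have "(\<lambda>i::nat. 3 - i) ` {0, 1, 2} = {1, 2, 3}" by (auto simp: image_iff)
  ultimately show ?thesis by simp
qed

text \<open>
  With \<open>u = t / 3\<close> we have \<open>3 u\<^sup>2 = 1\<close>, and the half-turn is the substitution with matrix rows \<open>(-u, 2u)\<close> and
  \<open>(-2u, u)\<close>, of determinant \<open>1\<close>.  Since its upper right entry does not vanish, it is a product of a
  lower, an upper and a lower unitriangular matrix, with parameters \<open>(1 - t) / 2\<close>, \<open>2 t / 3\<close> and
  \<open>- (1 + t) / 2\<close>; \<open>r 1\<close> exchanges the two variables and so turns lower matrices into upper ones.
\<close>

lemma half_turn_123_hyperbolic:
  assumes prime_field: "\<And>x::'a. \<exists>n. x = of_nat n" and three: "(3::'a) \<noteq> 0" and dd: "d * d' = 4"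
    and t: "t\<^sup>2 = (3::'a)"
  shows "half_turn a' d \<in> W {1, 2, 3}"
proof -
  obtain e where e: "d' = 2 * e" using two by (metis mult.commute nonzero_divide_eq_eq)
  have "2 * (d * e) = 2 * 2" using dd e by (simp add: mult.left_commute)
  then have de: "d * e = 2" using two unfolding mult_cancel_left by blast
  have de_left: "d * (e * x) = 2 * x" for x using de by (simp flip: mult.assoc)
  have "r 3 \<circ> r 2 = shear d e 1"
    by (auto simp: fun_eq_iff e de de_left algebra_simps)
  moreover have "r 3 \<circ> r 2 \<in> W {2, 3}" by (intro word_comp word_gen) auto
  ultimately have "shear d e k \<in> W {2, 3}" for k
    using word_one_parameter[where F = "shear d e" and c = 1, OF prime_field shear_zero shear_add[OF de]]
    by simp
  then have shear: "shear d e k \<in> W {1, 2, 3}" for k by (rule word_weaken) auto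
  define w y w' where "w = (1 - t) / 2" "y = 2 * t / 3" "w' = - (1 + t) / 2"
  define g where "g = shear d e w' \<circ> (r 1 \<circ> shear d e y \<circ> r 1) \<circ> shear d e w"
  have "g \<in> W {1, 2, 3}"
    unfolding g_def by (intro word_comp word_gen shear) auto
  moreover have "g v = half_turn a' d v" for v
  proof -
    have tt: "t * t = 3" "t * (t * x) = 3 * x" for x
      using t by (simp_all add: power2_eq_square flip: mult.assoc)
    have w: "w * (2 * x) = (1 - t) * x" "w' * (2 * x) = - (1 + t) * x" "y * (3 * x) = 2 * t * x" for x
      using two three by (simp_all add: w_y_w'_def)
    have "2 * w = 1 - t" "2 * w' = - (1 + t)" "3 * y = 2 * t"
      using two three by (simp_all add: w_y_w'_def)
    then have "2 * w * (2 * w) = 2 * (2 - t)" "2 * w' * (2 * w') = 2 * (2 + t)" "3 * y * (3 * y) = 3 * 4"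
      by (simp_all only:) (simp_all add: tt algebra_simps)
    then have "2 * (2 * w\<^sup>2) = 2 * (2 - t)" "2 * (2 * w'\<^sup>2) = 2 * (2 + t)" "3 * (3 * y\<^sup>2) = 3 * 4"
      by (simp_all only: power2_eq_square mult_ac)
    then have "2 * w\<^sup>2 = 2 - t" "2 * w'\<^sup>2 = 2 + t" "3 * y\<^sup>2 = 4"
      using two three unfolding mult_cancel_left by blast+
    then have w2: "w\<^sup>2 * (2 * x) = (2 - t) * x" "w'\<^sup>2 * (2 * x) = (2 + t) * x" "y\<^sup>2 * (3 * x) = 4 * x" for x
      by (metis mult.assoc mult.commute)+
    obtain x0 x1 x2 x3 where v: "v = (x0, x1, x2, x3)" by (cases v)
    have "e \<noteq> 0" using de two by auto
    \<comment> \<open>In these coordinates all intermediate vectors have polynomial entries in \<open>t\<close>, without denominators.\<close>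
    then obtain q0 q1 q2 q3 where q: "a' * x0 = 3 * q0" "x1 = 2 * (3 * q1)" "x2 = 3 * q2" "x3 = e * (3 * q3)"
      using two three by (metis nonzero_mult_div_cancel_left times_divide_eq_right)
    define P2 P3 m n R2 R3 where "P2 = q2 + (1 - t) * (q3 - q2) + (2 - t) * q1"
      "P3 = q3 + (1 - t) * q1 + (1 - t) * (q3 - q2) + (2 - t) * q1"
      "m = q0 - 2 * q1 + P2" "n = 2 * q0 + 2 * q3 - 3 * q1"
      "R2 = 3 * P2 + 4 * t * (P3 - P2) + 4 * m" "R3 = 3 * P3 + 2 * t * m + 4 * t * (P3 - P2) + 4 * m"
    note defs = this
    have shear_even: "shear d e k (y0, y1, y2, e * y3) =
      (y0, y1, y2 + k * (2 * (y3 - y2)) + k\<^sup>2 * y1, e * (y3 + k * y1 + k * (2 * (y3 - y2)) + k\<^sup>2 * y1))"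
      for k y0 y1 y2 y3
      by (simp add: de_left algebra_simps)
    have "shear d e w v = (x0, 2 * (3 * q1), 3 * P2, e * (3 * P3))"
      unfolding v q shear_even w w2 by (simp add: defs(1,2) algebra_simps)
    moreover have "r 1 (x0, 2 * (3 * q1), 3 * P2, e * (3 * P3)) = (x0, 3 * m, 3 * P2, e * (3 * P3))"
      by (simp add: q defs(3) algebra_simps)
    moreover have "shear d e y (x0, 3 * m, 3 * P2, e * (3 * P3)) = (x0, 3 * m, R2, e * R3)"
    proof -
      have yv: "y * (2 * (3 * P3 - 3 * P2)) = 4 * t * (P3 - P2)"
        using w(3)[of "2 * (P3 - P2)"] by (simp add: algebra_simps)
      show ?thesis unfolding shear_even yv w w2 by (simp add: defs(5,6) algebra_simps)
    qed
    moreover have "r 1 (x0, 3 * m, R2, e * R3) = (x0, 2 * n, R2, e * R3)"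
      by (simp add: q defs tt algebra_simps)
    moreover have "shear d e w' (x0, 2 * n, R2, e * R3) = half_turn a' d v"
    proof -
      have "(4 * a' * x0 + 2 * d * (e * (3 * q3))) = 3 * (4 * q0 + 4 * q3)"
        "(2 * a' * x0 + 4 * d * (e * (3 * q3))) = 3 * (2 * q0 + 8 * q3)"
        using q(1) by (simp_all add: de_left mult.assoc)
      then have "(4 * a' * x0 + 2 * d * (e * (3 * q3))) / 3 = 4 * q0 + 4 * q3"
        "(2 * a' * x0 + 4 * d * (e * (3 * q3))) / 3 = 2 * q0 + 8 * q3"
        using three by simp_all
      then have "half_turn a' d v = (x0, 2 * n, 2 * q0 + 8 * q3 - 3 * q2, e * (3 * q3))"
        unfolding v q(2-4) half_turn.simps by (simp add: defs(4))
      then show ?thesis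
        unfolding shear_even w w2 by (simp add: defs tt algebra_simps)
    qed
    ultimately show ?thesis by (simp only: g_def comp_apply)
  qed
  then have "g = half_turn a' d" by blast
  ultimately show ?thesis by (simp only:)
qed

lemma intersection_property_iff_euclidean:
  assumes prime_field: "\<And>x::'a. \<exists>n. x = of_nat n" and "d * d' = 3"
  shows "intersection_property r {..<4} \<longleftrightarrow> (3::'a) = 0"
proof
  assume "intersection_property r {..<4}"
  then show "(3::'a) = 0"
    using half_turn_012 half_turn_123_euclidean half_turn_not_12 assms
    unfolding intersection_property_iff by blast
next
  assume "(3::'a) = 0"
  then have "a = 0 \<or> a' = 0" "d = 0 \<or> d' = 0" using aa assms(2) by auto
  then show "intersection_property r {..<4}"
    unfolding intersection_property_iff using long_left long_right two_short by blast
qed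

lemma intersection_property_iff_hyperbolic:
  assumes prime_field: "\<And>x::'a. \<exists>n. x = of_nat n" and "d * d' = 4"
  shows "intersection_property r {..<4} \<longleftrightarrow> (3::'a) = 0 \<or> (\<nexists>t::'a. t\<^sup>2 = 3)"
proof
  assume "intersection_property r {..<4}"
  then show "(3::'a) = 0 \<or> (\<nexists>t::'a. t\<^sup>2 = 3)"
    using half_turn_012 half_turn_123_hyperbolic half_turn_not_12 assms
    unfolding intersection_property_iff by blast
next
  assume *: "(3::'a) = 0 \<or> (\<nexists>t::'a. t\<^sup>2 = 3)"
  show "intersection_property r {..<4}"
  proof (cases "(3::'a) = 0")
    case True
    then have "a = 0 \<or> a' = 0" using aa by auto
    then show ?thesis
      unfolding intersection_property_iff using long_left short_nondegenerate assms(2) by blast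
  next
    case False
    then show ?thesis
      unfolding intersection_property_iff using ends_inter_nonsquare assms(2) * by blast
  qed
qed

end

section \<open>From matrix groups to groups of maps\<close>

text \<open>
  An involution is its own inverse in the matrix group, so \<open>generate\<close> also consists of products of
  generators only.
\<close>

lemma word_image_generate:
  fixes \<phi> :: "'g \<Rightarrow> 'v \<Rightarrow> 'v"
  assumes "group G" and gens: "\<And>i. i \<in> I \<Longrightarrow> s i \<in> carrier G"
    and invol: "\<And>i. i \<in> I \<Longrightarrow> s i \<otimes>\<^bsub>G\<^esub> s i = \<one>\<^bsub>G\<^esub>"
    and one: "\<phi> \<one>\<^bsub>G\<^esub> = id"
    and mult: "\<And>x y. x \<in> carrier G \<Longrightarrow> y \<in> carrier G \<Longrightarrow> \<phi> (x \<otimes>\<^bsub>G\<^esub> y) = \<phi> x \<circ> \<phi> y"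
    and f: "\<And>i. i \<in> I \<Longrightarrow> \<phi> (s i) = f i"
  shows "\<phi> ` generate G (s ` I) = word_maps f I"
proof -
  interpret G: group G by fact
  have sub: "s ` I \<subseteq> carrier G" using gens by blast
  show ?thesis
  proof (intro equalityI subsetI)
    fix h assume "h \<in> \<phi> ` generate G (s ` I)"
    then obtain g where "g \<in> generate G (s ` I)" "h = \<phi> g" by blast
    have "\<phi> g \<in> word_maps f I"
      using \<open>g \<in> generate G (s ` I)\<close>
    proof (induction rule: generate.induct)
      case one
      show ?case using assms(4) word_id by metis
    next
      case (incl h)
      then show ?case using f word_gen by (metis imageE)
    next
      case (inv h)
      then obtain i where "i \<in> I" "h = s i" by blast
      moreover then have "inv\<^bsub>G\<^esub> h = h" using gens invol by (metis G.inv_equality)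
      ultimately show ?case using f word_gen by metis
    next
      case (eng h1 h2)
      then show ?case using mult G.generate_in_carrier[OF sub] word_comp by metis
    qed
    then show "h \<in> word_maps f I" using \<open>h = \<phi> g\<close> by simp
  next
    fix h assume "h \<in> word_maps f I"
    then show "h \<in> \<phi> ` generate G (s ` I)"
    proof (induction rule: word_maps.induct)
      case word_id
      show ?case using one generate.one by (metis imageI)
    next
      case (word_step i g)
      then obtain x where x: "x \<in> generate G (s ` I)" "g = \<phi> x" by blast
      have "s i \<otimes>\<^bsub>G\<^esub> x \<in> generate G (s ` I)"
        using generate.eng[OF generate.incl[OF imageI[OF word_step(1)]] x(1)] .
      moreover have "\<phi> (s i \<otimes>\<^bsub>G\<^esub> x) = f i \<circ> g"
        using mult[of "s i" x] gens f word_step(1) x G.generate_in_carrier[OF sub x(1)] by simp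
      ultimately show ?case by (metis imageI)
    qed
  qed
qed

lemma C_group_iff_intersection_property:
  fixes \<phi> :: "'g \<Rightarrow> 'v \<Rightarrow> 'v"
  assumes "group G" and gens: "\<And>i. i < n \<Longrightarrow> s i \<in> carrier G"
    and invol: "\<And>i. i < n \<Longrightarrow> s i \<otimes>\<^bsub>G\<^esub> s i = \<one>\<^bsub>G\<^esub>"
    and one: "\<phi> \<one>\<^bsub>G\<^esub> = id"
    and mult: "\<And>x y. x \<in> carrier G \<Longrightarrow> y \<in> carrier G \<Longrightarrow> \<phi> (x \<otimes>\<^bsub>G\<^esub> y) = \<phi> x \<circ> \<phi> y"
    and inj: "inj_on \<phi> (carrier G)"
    and f: "\<And>i. i < n \<Longrightarrow> \<phi> (s i) = f i"
  shows "is_C_group (G\<lparr>carrier := generate G (s ` {..<n})\<rparr>) n s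
    \<longleftrightarrow> intersection_property f {..<n}"
proof -
  interpret G: group G by fact
  let ?H = "G\<lparr>carrier := generate G (s ` {..<n})\<rparr>"
  have gen: "generate ?H (s ` I) = generate G (s ` I)" if "I \<subseteq> {..<n}" for I
  proof (rule G.generate_consistent)
    show "s ` I \<subseteq> generate G (s ` {..<n})"
      using that by (auto intro: generate.incl)
    show "subgroup (generate G (s ` {..<n})) G"
      using gens by (intro G.generate_is_subgroup) auto
  qed
  have img: "\<phi> ` generate G (s ` I) = word_maps f I" if "I \<subseteq> {..<n}" for I
    using that gens invol one mult f by (intro word_image_generate[OF \<open>group G\<close>]) auto
  have car: "generate G (s ` I) \<subseteq> carrier G" if "I \<subseteq> {..<n}" for I
    using that gens by (intro G.generate_incl) auto
  have iff: "generate ?H (s ` I) \<inter> generate ?H (s ` J) = generate ?H (s ` (I \<inter> J)) \<longleftrightarrow>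
    word_maps f I \<inter> word_maps f J = word_maps f (I \<inter> J)" if IJ: "I \<subseteq> {..<n}" "J \<subseteq> {..<n}" for I J
  proof -
    have IJ': "I \<inter> J \<subseteq> {..<n}" using IJ by blast
    have "generate ?H (s ` I) \<inter> generate ?H (s ` J) = generate ?H (s ` (I \<inter> J)) \<longleftrightarrow>
      generate G (s ` I) \<inter> generate G (s ` J) = generate G (s ` (I \<inter> J))"
      by (simp only: gen[OF IJ(1)] gen[OF IJ(2)] gen[OF IJ'])
    also have "\<dots> \<longleftrightarrow> \<phi> ` (generate G (s ` I) \<inter> generate G (s ` J)) = \<phi> ` generate G (s ` (I \<inter> J))"
      by (rule inj_on_image_eq_iff[OF inj _ car[OF IJ'], symmetric]) (use car[OF IJ(1)] in blast)
    also have "\<phi> ` (generate G (s ` I) \<inter> generate G (s ` J)) = word_maps f I \<inter> word_maps f J"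
      using inj_on_image_Int[OF inj car[OF IJ(1)] car[OF IJ(2)]] img IJ by simp
    finally show ?thesis by (simp only: img[OF IJ'])
  qed
  show ?thesis unfolding is_C_group_def intersection_property_def
    by (intro iff_allI imp_cong refl iff)
qed

definition quad_vec :: "'a::field quad \<Rightarrow> 'a vec" where
  "quad_vec v = vec 4 (\<lambda>i. coord i v)"

definition mat_quad :: "'a::field mat \<Rightarrow> 'a quad \<Rightarrow> 'a quad" where
  "mat_quad A v = (let w = A *\<^sub>v quad_vec v in (w $ 0, w $ 1, w $ 2, w $ 3))"

lemma quad_vec_mat_quad:
  assumes "A \<in> carrier_mat 4 4"
  shows "quad_vec (mat_quad A v) = A *\<^sub>v quad_vec v"
proof (rule eq_vecI)
  fix i assume "i < dim_vec (A *\<^sub>v quad_vec v)"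
  then have "i < 4" using assms by simp
  then have "i = 0 \<or> i = 1 \<or> i = 2 \<or> i = 3" by linarith
  then show "quad_vec (mat_quad A v) $ i = (A *\<^sub>v quad_vec v) $ i"
    using \<open>i < 4\<close> by (auto simp: quad_vec_def mat_quad_def Let_def)
qed (use assms in \<open>simp add: quad_vec_def\<close>)

lemma mat_quad_mult:
  assumes "A \<in> carrier_mat 4 4" "B \<in> carrier_mat 4 4"
  shows "mat_quad (A * B :: 'a::field mat) = mat_quad A \<circ> mat_quad B"
proof
  fix v :: "'a quad"
  have "quad_vec v \<in> carrier_vec 4" by (simp add: quad_vec_def)
  then have "(A * B) *\<^sub>v quad_vec v = A *\<^sub>v (B *\<^sub>v quad_vec v)"
    using assms by simp
  then show "mat_quad (A * B) v = (mat_quad A \<circ> mat_quad B) v"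
    using quad_vec_mat_quad[OF assms(2)] by (simp add: mat_quad_def)
qed

lemma mat_quad_one: "mat_quad (1\<^sub>m 4) = id"
proof
  fix v :: "'a quad"
  have "1\<^sub>m 4 *\<^sub>v quad_vec v = quad_vec v" by (rule one_mult_mat_vec) (simp add: quad_vec_def)
  then show "mat_quad (1\<^sub>m 4) v = id v" by (cases v) (simp add: mat_quad_def quad_vec_def)
qed

lemma mat_quad_inj: "inj_on mat_quad (carrier_mat 4 4 :: 'a::field mat set)"
proof
  fix A B :: "'a mat" assume A: "A \<in> carrier_mat 4 4" and B: "B \<in> carrier_mat 4 4"
    and eq: "mat_quad A = mat_quad B"
  show "A = B"
  proof (rule eq_matI)
    fix i j assume "i < dim_row B" "j < dim_col B"
    then have ij: "i < 4" "j < 4" using B by auto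
    define v where "v = (if j = 0 then 1 else 0::'a, if j = 1 then 1 else 0::'a, if j = 2 then 1 else 0::'a, if j = 3 then 1 else 0::'a)"
    have v: "quad_vec v = unit_vec 4 j"
    proof (rule eq_vecI)
      fix k assume "k < dim_vec (unit_vec 4 j :: 'a vec)"
      then have "k < 4" by simp
      then have "k = 0 \<or> k = 1 \<or> k = 2 \<or> k = 3" by linarith
      then show "quad_vec v $ k = unit_vec 4 j $ k" using ij by (auto simp: v_def quad_vec_def)
    qed (simp add: quad_vec_def)
    have "M $$ (i, j) = quad_vec (mat_quad M v) $ i" if "M \<in> carrier_mat 4 4" for M :: "'a mat"
      using that ij unfolding quad_vec_mat_quad[OF that] v by (simp add: mult_mat_vec_def)
    then show "A $$ (i, j) = B $$ (i, j)" using A B eq by simp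
  qed (use A B in auto)
qed

section \<open>Three as a quadratic residue\<close>

text \<open>
  By reciprocity the symbol is \<open>(-1) ^ ((p - 1) div 2)\<close> times the quadratic character of \<open>p\<close> modulo \<open>3\<close>,
  hence depends on \<open>p\<close> modulo \<open>4\<close> and modulo \<open>3\<close>.
\<close>

lemma three_square_iff:
  assumes "prime p" "3 < p"
  shows "QuadRes (int p) 3 \<longleftrightarrow> \<not> ([int p = 5] (mod 12) \<or> [int p = -5] (mod 12))"
proof -
  have rec: "Legendre p 3 * Legendre 3 p = (-1::int) ^ ((p - 1) div 2 * ((3 - 1) div 2))"
    using Quadratic_Reciprocity[of p 3] assms by simp
  have "\<not> p dvd 3"
    using assms by (auto dest: dvd_imp_le)
  then have "\<not> [3 = 0] (mod int p)"
    by (metis cong_0_iff int_dvd_int_iff of_nat_numeral)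
  then have L3: "Legendre 3 p = (if QuadRes p 3 then 1 else -1)"
    by (simp add: Legendre_def)
  have n2: "\<not> 2 dvd p"
    using assms prime_odd_nat[of p] by simp
  have n3: "\<not> 3 dvd p"
    using primes_dvd_imp_eq[of 3 p] assms by auto
  have "\<not> QuadRes 3 2"
  proof
    assume "QuadRes 3 2"
    then obtain y :: int where "[y\<^sup>2 = 2] (mod 3)" unfolding QuadRes_def by blast
    moreover have "y mod 3 = 0 \<or> y mod 3 = 1 \<or> y mod 3 = 2" by presburger
    then have "y\<^sup>2 mod 3 = 0 \<or> y\<^sup>2 mod 3 = 1"
      by (auto simp: power_mod[of y 3 2, symmetric])
    ultimately show False by (auto simp: cong_def)
  qed
  moreover have "QuadRes 3 1" unfolding QuadRes_def by (intro exI[of _ 1]) simp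
  moreover have "QuadRes 3 (int p) \<longleftrightarrow> QuadRes 3 (int p mod 3)"
    by (simp add: QuadRes_def cong_def)
  moreover have "\<not> [int p = 0] (mod 3)"
    using n3 by (metis cong_0_iff int_dvd_int_iff of_nat_numeral)
  moreover have "int p mod 3 = 1 \<or> int p mod 3 = 2" "p mod 3 = 1 \<longleftrightarrow> int p mod 3 = 1"
    using n3 by presburger+
  ultimately have Lp: "Legendre p 3 = (if p mod 3 = 1 then 1 else -1)"
    unfolding Legendre_def by (metis zero_neq_one)
  have "p mod 12 = 1 \<or> p mod 12 = 5 \<or> p mod 12 = 7 \<or> p mod 12 = 11"
    using n2 n3 by presburger
  moreover have c: "[int p = 5] (mod 12) \<longleftrightarrow> p mod 12 = 5" "[int p = -5] (mod 12) \<longleftrightarrow> p mod 12 = 7"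
  proof -
    have "int p mod 12 = int (p mod 12)" by (simp add: zmod_int)
    then show "[int p = 5] (mod 12) \<longleftrightarrow> p mod 12 = 5" "[int p = -5] (mod 12) \<longleftrightarrow> p mod 12 = 7"
      unfolding cong_def by simp_all
  qed
  moreover have "even ((p - 1) div 2) \<longleftrightarrow> p mod 4 = 1"
  proof -
    obtain k where "p = 2 * k + 1" using n2 by (auto elim: oddE)
    then show ?thesis by simp presburger
  qed
  moreover have "p mod 3 = p mod 12 mod 3" "p mod 4 = p mod 12 mod 4"
    by (simp_all add: mod_mod_cancel)
  ultimately show ?thesis
    using rec unfolding L3 Lp c by (elim disjE) (auto simp: minus_one_power_iff split: if_splits)
qed

lemma mod_ring_of_int_eq_iff:
  "(of_int x :: 'p::prime_card mod_ring) = of_int y \<longleftrightarrow> [x = y] (mod int CARD('p))"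
  by (simp add: of_int_eq_iff_cong_CHAR)

lemma mod_ring_square_iff:
  "(\<exists>t :: 'p::prime_card mod_ring. t\<^sup>2 = of_int k) \<longleftrightarrow> QuadRes (int CARD('p)) k"
proof -
  have "(\<exists>t :: 'p mod_ring. t\<^sup>2 = of_int k) \<longleftrightarrow> (\<exists>y::int. (of_int y :: 'p mod_ring)\<^sup>2 = of_int k)"
    by (metis of_int_of_nat_eq surj_of_nat_mod_ring)
  also have "\<dots> \<longleftrightarrow> (\<exists>y. [y\<^sup>2 = k] (mod int CARD('p)))"
    by (simp only: mod_ring_of_int_eq_iff flip: of_int_power)
  finally show ?thesis by (simp add: QuadRes_def)
qed

section \<open>Cartan integers of a basic system\<close>

text \<open>
  In a basic system the quotient is an integer, so the floor is exact.
\<close>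

definition cartan :: "('v::real_vector \<Rightarrow> 'v \<Rightarrow> real) \<Rightarrow> (nat \<Rightarrow> 'v) \<Rightarrow> nat \<Rightarrow> nat \<Rightarrow> int" where
  "cartan B b i j = \<lfloor>2 * B (b i) (b j) / B (b i) (b i)\<rfloor>"

lemma cartan_real:
  assumes "basic_system B ps r b" "i < rank ps" "j < rank ps"
  shows "real_of_int (cartan B b i j) = 2 * B (b i) (b j) / B (b i) (b i)"
  using assms unfolding basic_system_def cartan_def by (metis of_int_floor)

lemma cartan_diag:
  assumes "basic_system B ps r b" "i < rank ps"
  shows "cartan B b i i = 2"
proof -
  have "B (b i) (b i) > 0" using assms by (simp add: basic_system_def)
  then have "real_of_int (cartan B b i i) = 2" using cartan_real[OF assms assms(2)] by simp
  then show ?thesis by linarith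
qed

lemma cartan_far:
  assumes "basic_system B ps r b" "i < rank ps" "j < rank ps" "i + 2 \<le> j \<or> j + 2 \<le> i"
  shows "cartan B b i j = 0"
proof -
  have "B (b i) (b j) = 0"
    using assms unfolding basic_system_def symmetric_bilinear_form_def by metis
  then show ?thesis by (simp add: cartan_def)
qed

lemma cartan_adjacent:
  assumes sys: "basic_system B ps r b" and i: "Suc i < rank ps" and pos: "cos_mark (ps ! i) > 0"
  shows "real_of_int (cartan B b i (Suc i) * cartan B b (Suc i) i) = 4 * (cos_mark (ps ! i))\<^sup>2"
    and "cartan B b i (Suc i) < 0" and "cartan B b (Suc i) i < 0"
proof -
  let ?x = "B (b i) (b i)" and ?y = "B (b (Suc i)) (b (Suc i))" and ?z = "B (b i) (b (Suc i))"
  have x: "?x > 0" and y: "?y > 0" and z: "?z = - cos_mark (ps ! i) * sqrt (?x * ?y)"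
    and sym: "B (b (Suc i)) (b i) = ?z"
    using sys i by (auto simp: basic_system_def symmetric_bilinear_form_def)
  have c1: "real_of_int (cartan B b i (Suc i)) = 2 * ?z / ?x"
    and c2: "real_of_int (cartan B b (Suc i) i) = 2 * ?z / ?y"
    using cartan_real[OF sys, of i "Suc i"] cartan_real[OF sys, of "Suc i" i] i sym by simp_all
  have "?z\<^sup>2 = (cos_mark (ps ! i))\<^sup>2 * (?x * ?y)"
    unfolding z using x y by (simp add: power_mult_distrib)
  then show "real_of_int (cartan B b i (Suc i) * cartan B b (Suc i) i) = 4 * (cos_mark (ps ! i))\<^sup>2"
    using x y unfolding of_int_mult c1 c2 by (simp add: power2_eq_square)
  have "?z < 0" unfolding z using pos x y by simp
  then have "real_of_int (cartan B b i (Suc i)) < 0" "real_of_int (cartan B b (Suc i) i) < 0"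
    unfolding c1 c2 using x y by (simp_all add: divide_neg_pos)
  then show "cartan B b i (Suc i) < 0" "cartan B b (Suc i) i < 0" by simp_all
qed

lemma reduced_gen_entry:
  assumes sys: "basic_system B ps r b" and ij: "i < rank ps" "k < rank ps" "j < rank ps"
  shows "(reduced_gen ps r b i :: 'p::prime_card mod_ring mat) $$ (k, j)
    = (if k = j then 1 else 0) - (if k = i then of_int (cartan B b i j) else 0)"
proof -
  let ?S = "b ` {..<rank ps}"
  have basis: "inj_on b {..<rank ps}" "independent ?S" "span ?S = UNIV"
    using sys by (simp_all add: basic_system_def indexed_basis_def)
  have "B (b j) (b i) = B (b i) (b j)" using sys by (simp add: basic_system_def symmetric_bilinear_form_def)
  then have "r i (b j) = b j - real_of_int (cartan B b i j) *\<^sub>R b i"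
    using sys ij cartan_real[OF sys, of i j] by (simp add: basic_system_def)
  then have "representation ?S (r i (b j)) (b k)
    = representation ?S (b j) (b k) - real_of_int (cartan B b i j) * representation ?S (b i) (b k)"
    using basis by (simp add: real_vector.representation_diff real_vector.representation_scale)
  also have "representation ?S (b j) (b k) = (if k = j then 1 else 0)"
    using basis(2) ij by (subst real_vector.representation_basis) (auto dest: inj_onD[OF basis(1)])
  also have "representation ?S (b i) (b k) = (if k = i then 1 else 0)"
    using basis(2) ij by (subst real_vector.representation_basis) (auto dest: inj_onD[OF basis(1)])
  finally have "representation ?S (r i (b j)) (b k)
    = real_of_int ((if k = j then 1 else 0) - (if k = i then cartan B b i j else 0))" by simp
  then show ?thesis
    using ij by (simp add: reduced_gen_def reduce_mat_def matrix_wrt_def)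
qed

lemma reduced_gen_string_refl:
  assumes sys: "basic_system B ps r b" and rank: "rank ps = 4"
    and mid: "cartan B b 1 2 = -1" "cartan B b 2 1 = -1" and "i < 4"
  shows "mat_quad (reduced_gen ps r b i :: 'p::prime_card mod_ring mat)
    = string_refl (- of_int (cartan B b 0 1)) (- of_int (cartan B b 1 0))
        (- of_int (cartan B b 2 3)) (- of_int (cartan B b 3 2)) i"
proof
  fix v :: "'p mod_ring quad"
  obtain x0 x1 x2 x3 where v: "v = (x0, x1, x2, x3)" by (cases v)
  let ?A = "reduced_gen ps r b i :: 'p mod_ring mat"
  have row: "(reduced_gen ps r b l *\<^sub>v quad_vec v) $ k = reduced_gen ps r b l $$ (k, 0) * x0
      + reduced_gen ps r b l $$ (k, 1) * x1 + reduced_gen ps r b l $$ (k, 2) * x2 + reduced_gen ps r b l $$ (k, 3) * x3"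
    if "k < 4" for k l
  proof -
    have "dim_row (reduced_gen ps r b l :: 'p mod_ring mat) = 4" "dim_col (reduced_gen ps r b l :: 'p mod_ring mat) = 4"
      using rank by (simp_all add: reduced_gen_def reduce_mat_def matrix_wrt_def)
    then show ?thesis
      using that by (simp add: scalar_prod_def quad_vec_def v numeral_eq_Suc)
  qed
  note entry = reduced_gen_entry[OF sys, unfolded rank]
  note diag = cartan_diag[OF sys, unfolded rank] and far = cartan_far[OF sys, unfolded rank]
  have "i = 0 \<or> i = 1 \<or> i = 2 \<or> i = 3" using \<open>i < 4\<close> by linarith
  then show "mat_quad ?A v = string_refl (- of_int (cartan B b 0 1)) (- of_int (cartan B b 1 0))
        (- of_int (cartan B b 2 3)) (- of_int (cartan B b 3 2)) i v"
    unfolding mat_quad_def Let_def v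
    by (elim disjE) (simp_all add: row[unfolded v] entry diag far mid[simplified] algebra_simps)
qed

lemma reduction_is_C_group_iff:
  assumes sys: "basic_system B ps r b" and rank: "rank ps = 4"
    and mid: "cartan B b 1 2 = -1" "cartan B b 2 1 = -1"
  shows "reduction_is_C_group TYPE('p::prime_card) ps r b \<longleftrightarrow>
    intersection_property (string_refl (- of_int (cartan B b 0 1)) (- of_int (cartan B b 1 0))
        (- of_int (cartan B b 2 3)) (- of_int (cartan B b 3 2) :: 'p mod_ring)) {..<4}"
proof -
  let ?G = "GL TYPE('p) 4" and ?s = "reduced_gen ps r b :: nat \<Rightarrow> 'p mod_ring mat"
  let ?f = "string_refl (- of_int (cartan B b 0 1)) (- of_int (cartan B b 1 0))
        (- of_int (cartan B b 2 3)) (- of_int (cartan B b 3 2) :: 'p mod_ring)"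
  let ?M = "ring_mat TYPE('p mod_ring) 4 ()"
  interpret M: ring ?M by (rule ring_mat)
  have G: "group ?G" unfolding GL_def by (rule M.units_group)
  have one: "\<one>\<^bsub>?G\<^esub> = 1\<^sub>m 4" by (simp add: GL_def units_of_one ring_mat_simps)
  have mult: "x \<otimes>\<^bsub>?G\<^esub> y = x * y" for x y by (simp add: GL_def units_of_mult ring_mat_simps)
  have car: "carrier ?G \<subseteq> carrier_mat 4 4"
    by (auto simp: GL_def units_of_carrier Units_def ring_mat_simps)
  have gen_dim: "?s i \<in> carrier_mat 4 4" for i
    using rank by (simp add: reduced_gen_def reduce_mat_def matrix_wrt_def)
  have gen: "mat_quad (?s i) = ?f i" if "i < 4" for i
    using reduced_gen_string_refl[OF sys rank mid that] .
  have invol: "?s i * ?s i = 1\<^sub>m 4" if "i < 4" for i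
  proof (rule inj_onD[OF mat_quad_inj])
    show "mat_quad (?s i * ?s i) = mat_quad (1\<^sub>m 4)"
      unfolding mat_quad_mult[OF gen_dim gen_dim] gen[OF that] mat_quad_one
      by (auto simp: fun_eq_iff)
  qed (use gen_dim[of i] in auto)
  have gen_car: "?s i \<in> carrier ?G" if "i < 4" for i
    using gen_dim[of i] invol[OF that]
    by (auto simp: GL_def units_of_carrier Units_def ring_mat_simps)
  have "is_C_group (?G\<lparr>carrier := generate ?G (?s ` {..<4})\<rparr>) 4 ?s \<longleftrightarrow> intersection_property ?f {..<4}"
    by (rule C_group_iff_intersection_property[OF G, where \<phi> = mat_quad])
      (use gen_car invol gen car in \<open>auto simp: one mult mat_quad_one intro!: mat_quad_mult
         inj_on_subset[OF mat_quad_inj]\<close>)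
  then show ?thesis
    by (simp add: reduction_is_C_group_def reduced_group_def rank)
qed

theorem theorem3p5:
  fixes B :: "'v::real_vector \<Rightarrow> 'v \<Rightarrow> real"
    and r :: "nat \<Rightarrow> 'v \<Rightarrow> 'v"
    and b :: "nat \<Rightarrow> 'v"
    and m :: enat
    and p :: nat
  assumes "m = 6 \<or> m = \<infinity>"
    and "basic_system B [6, 3, m] r b"
    and "p = CARD('p::prime_card)"
    and "p \<ge> 3"
  shows "(m = 6 \<longrightarrow>
            (reduction_is_C_group TYPE('p) [6, 3, m] r b \<longleftrightarrow> p = 3)) \<and>
         (m = \<infinity> \<longrightarrow>
            (reduction_is_C_group TYPE('p) [6, 3, m] r b \<longleftrightarrow>
               p = 3 \<or> [int p = 5] (mod 12) \<or> [int p = -5] (mod 12)))"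
proof -
  let ?ps = "[6, 3, m]" and ?c = "cartan B b"
  have rank: "rank ?ps = 4" by (simp add: rank_def)
  have marks: "cos_mark 6 = sqrt 3 / 2" "cos_mark 3 = 1 / 2" "cos_mark \<infinity> = 1"
    by (simp_all add: cos_mark_def cos_30 cos_60 numeral_eq_enat)
  note adj = cartan_adjacent[OF assms(2), unfolded rank]
  have "real_of_int (?c 0 1 * ?c 1 0) = 3"
    using adj(1)[of 0] by (simp add: marks power_divide)
  then have c01: "?c 0 1 * ?c 1 0 = 3" by linarith
  have "real_of_int (?c 1 2 * ?c 2 1) = 1" "?c 1 2 < 0" "?c 2 1 < 0"
    using adj[of 1] by (simp_all add: marks power_divide numeral_2_eq_2)
  then have "?c 1 2 * ?c 2 1 = 1" by linarith
  with \<open>?c 1 2 < 0\<close> \<open>?c 2 1 < 0\<close> have mid: "?c 1 2 = -1" "?c 2 1 = -1"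
    using pos_zmult_eq_1_iff_lemma[of "?c 1 2" "?c 2 1"] by (auto simp: zmult_eq_1_iff)
  have c23: "?c 2 3 * ?c 3 2 = (if m = 6 then 3 else 4)"
  proof -
    have "real_of_int (?c 2 3 * ?c 3 2) = real_of_int (if m = 6 then 3 else 4)"
      using adj(1)[of 2] assms(1) by (auto simp: marks power_divide numeral_3_eq_3 numeral_2_eq_2)
    then show ?thesis by (simp only: of_int_eq_iff)
  qed
  have "prime p" using assms(3) prime_card by metis
  have zero_iff: "(of_int k :: 'p mod_ring) = 0 \<longleftrightarrow> int p dvd k" for k
    using mod_ring_of_int_eq_iff[of k 0, where 'p = 'p] assms(3) by (simp add: cong_0_iff)
  have two: "(2 :: 'p mod_ring) \<noteq> 0"
    using zero_iff[of 2] assms(4) by (auto dest: zdvd_imp_le)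
  have three: "(3 :: 'p mod_ring) = 0 \<longleftrightarrow> p = 3"
    using zero_iff[of 3] assms(4) by (auto dest: zdvd_imp_le)
  have prime_field: "\<exists>n. x = of_nat n" for x :: "'p mod_ring"
    using surj_of_nat_mod_ring by metis
  have aa: "- of_int (?c 0 1) * - of_int (?c 1 0) = (3 :: 'p mod_ring)"
    unfolding minus_mult_minus of_int_mult[symmetric] c01 by simp
  have dd: "- of_int (?c 2 3) * - of_int (?c 3 2) = (if m = 6 then 3 else 4 :: 'p mod_ring)"
    unfolding minus_mult_minus of_int_mult[symmetric] c23 by simp
  interpret string_group "- of_int (?c 0 1)" "- of_int (?c 1 0)" "- of_int (?c 2 3)"
    "- of_int (?c 3 2) :: 'p mod_ring"
    using two aa by unfold_locales
  note iff = reduction_is_C_group_iff[OF assms(2) rank mid, where 'p = 'p]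
  have "p = 3 \<or> 3 < p" using assms(4) by linarith
  then have square: "p = 3 \<or> (\<nexists>t :: 'p mod_ring. t\<^sup>2 = 3) \<longleftrightarrow>
    p = 3 \<or> [int p = 5] (mod 12) \<or> [int p = -5] (mod 12)"
    using mod_ring_square_iff[of 3, where 'p = 'p] three_square_iff[OF \<open>prime p\<close>] assms(3) by auto
  show ?thesis
    using intersection_property_iff_euclidean[OF prime_field] 
      intersection_property_iff_hyperbolic[OF prime_field] dd iff three square by auto
qed

end
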